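(* Let $\mu$ be a positive Radon measure on $\mathbb{R}^d$ with bounded support, let $\alpha\in[0,1]$ and $\varepsilon>0$. Let $(\chi_n)_{n\ge1}\subset\mathcal{IP}(\mu)$ be a sequence of admissible irrigation plans, all parameterized by arc-length, whose stopping times $T_n(\theta)$ satisfy $$\int_\Theta T_n(\theta)\,d\theta\le C\qquad\text{for all } n\ge1$$ for some constant $C>0$. Assume that there exists an admissible irrigation plan $\chi\in\mathcal{IP}(\mu)$ such that $\chi_n\to\chi$. Then $$\liminf_{n\to\infty}\mathcal{E}^\alpha_\varepsilon(\chi_n)\ \ge\ \mathcal{E}^\alpha_\varepsilon(\chi).$$
   Context: Let $\mathbb{R}_+=[0,\infty)$, $M=\mu(\mathbb{R}^d)$, $\Theta=[0,M]$ with Lebesgue measure. An admissible irrigation plan for $\mu$ is a measurable map $\chi:\Theta\times\mathbb{R}_+\to\mathbb{R}^d$ such that: (i) for each $\theta\in\Theta$ the path $t\mapsto\chi(\theta,t)$ is 1-Lipschitz and eventually constant, with stopping time $T(\theta)=\inf\{t>0:\chi(\theta,t')=\chi(\theta,t)\ \text{for all } t'\ge t\}$; (ii) $\chi(\theta,0)=0$ for all $\theta\in\Theta$; (iii) the push-forward of Lebesgue measure on $[0,M]$ under $\theta\mapsto\chi(\theta,T(\theta))$ equals $\mu$. $\mathcal{IP}(\mu)$ denotes the set of all such plans, and $\dot\chi=\partial\chi/\partial t$. A plan is parameterized by arc-length if, for each $\theta$, $|\dot\chi(\theta,t)|=1$ for a.e. $t\in(0,T(\theta))$ and $|\dot\chi(\theta,t)|=0$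 for $t>T(\theta)$. Convergence: for 1-Lipschitz $\gamma_0,\gamma_1:\mathbb{R}_+\to\mathbb{R}^d$ set $d(\gamma_0,\gamma_1)=\sup_{k\ge1}\frac1k\|\gamma_0-\gamma_1\|_{L^\infty([0,k])}$. For $\chi_n,\chi\in\mathcal{IP}(\mu)$, $\chi_n\to\chi$ means $d(\chi_n(\theta,\cdot),\chi(\theta,\cdot))\to0$ for a.e. $\theta\in\Theta$. Mollified cost: fix a non-increasing Lipschitz function $J:\mathbb{R}_+\to\mathbb{R}_+$ with $J(0)=1$, $\lim_{r\to+\infty}J(r)=0$, and set $J_\varepsilon(r)=J(r/\varepsilon)$, $$W_\varepsilon(x,\chi)=\int_\Theta J_\varepsilon\Big(\min_{t\ge0}|\chi(\theta,t)-x|\Big)d\theta,\qquad \mathcal{E}^\alpha_\varepsilon(\chi)=\int_\Theta\int_{\mathbb{R}_+}\big[W_\varepsilon(\chi(\theta,t),\chi)\big]^{\alpha-1}|\dot\chi(\theta,t)|\,dt\,d\theta .$$ Costs take values in $[0,+\infty]$, with the conventions $0^{\alpha-1}=+\infty$ if $\alpha<1$, $0^0=1$, and $0\cdot\infty=0$. *)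

theory Defs
  imports "HOL-Probability.Essential_Supremum"
begin

definition radon_measure :: "(real ^ 'd) measure \<Rightarrow> bool" where
  "radon_measure \<mu> \<longleftrightarrow> sets \<mu> = sets borel \<and> (\<forall>K. compact K \<longrightarrow> emeasure \<mu> K < \<infinity>)"

definition msupport :: "(real ^ 'd) measure \<Rightarrow> (real ^ 'd) set" where
  "msupport \<mu> = {x. \<forall>U. open U \<and> x \<in> U \<longrightarrow> emeasure \<mu> U > 0}"

definition Theta :: "(real ^ 'd) measure \<Rightarrow> real set" where
  "Theta \<mu> = {0..measure \<mu> UNIV}"

definition stopping_time :: "(real \<Rightarrow> real ^ 'd) \<Rightarrow> real" where
  "stopping_time \<gamma> = Inf {t. t > 0 \<and> (\<forall>t'\<ge>t. \<gamma> t' = \<gamma> t)}"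

text \<open>Plans are total functions of \<open>\<theta>\<close> and \<open>t\<close>; only their values for \<open>\<theta> \<in> Theta \<mu>\<close> and
  \<open>t \<ge> 0\<close> matter below. Measurability is Lebesgue measurability on \<open>Theta \<mu> \<times> {0..}\<close>, which is
  implied by Borel measurability.\<close>

definition irrigation_plans :: "(real ^ 'd) measure \<Rightarrow> (real \<Rightarrow> real \<Rightarrow> real ^ 'd) set" where
  "irrigation_plans \<mu> = {chi.
     (\<lambda>(\<theta>, t). chi \<theta> t) \<in> borel_measurable (lebesgue_on (Theta \<mu> \<times> {0..})) \<and>
     (\<forall>\<theta>\<in>Theta \<mu>. 1-lipschitz_on {0..} (chi \<theta>) \<and> (\<exists>t\<ge>0. \<forall>t'\<ge>t. chi \<theta> t' = chi \<theta> t)) \<and>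
     (\<forall>\<theta>\<in>Theta \<mu>. chi \<theta> 0 = 0) \<and>
     distr (lebesgue_on (Theta \<mu>)) borel (\<lambda>\<theta>. chi \<theta> (stopping_time (chi \<theta>))) = \<mu>}"

text \<open>The time derivative of a Lipschitz path exists for almost every \<open>t\<close>; elsewhere
  \<^const>\<open>vector_derivative\<close> has an unspecified value.\<close>

definition speed :: "(real \<Rightarrow> real ^ 'd) \<Rightarrow> real \<Rightarrow> real" where
  "speed \<gamma> t = norm (vector_derivative \<gamma> (at t within {0..}))"

definition arc_length_parameterized ::
    "(real ^ 'd) measure \<Rightarrow> (real \<Rightarrow> real \<Rightarrow> real ^ 'd) \<Rightarrow> bool" where
  "arc_length_parameterized \<mu> chi \<longleftrightarrow> (\<forall>\<theta>\<in>Theta \<mu>.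
     (AE t in lebesgue_on {0<..<stopping_time (chi \<theta>)}. speed (chi \<theta>) t = 1) \<and>
     (\<forall>t>stopping_time (chi \<theta>). speed (chi \<theta>) t = 0))"

definition path_dist :: "(real \<Rightarrow> real ^ 'd) \<Rightarrow> (real \<Rightarrow> real ^ 'd) \<Rightarrow> ereal" where
  "path_dist \<gamma>\<^sub>0 \<gamma>\<^sub>1 = (SUP k\<in>{1::nat..}.
     ereal (1 / real k) * esssup (lebesgue_on {0..real k}) (\<lambda>t. ereal (norm (\<gamma>\<^sub>0 t - \<gamma>\<^sub>1 t))))"

definition plans_converge ::
    "(real ^ 'd) measure \<Rightarrow> (nat \<Rightarrow> real \<Rightarrow> real \<Rightarrow> real ^ 'd) \<Rightarrow>
     (real \<Rightarrow> real \<Rightarrow> real ^ 'd) \<Rightarrow> bool" where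
  "plans_converge \<mu> chis chi \<longleftrightarrow>
     (AE \<theta> in lebesgue_on (Theta \<mu>). (\<lambda>n. path_dist (chis n \<theta>) (chi \<theta>)) \<longlonglongrightarrow> 0)"

definition mollifier :: "(real \<Rightarrow> real) \<Rightarrow> bool" where
  "mollifier J \<longleftrightarrow> (\<forall>r\<ge>0. J r \<ge> 0) \<and> antimono_on {0..} J \<and> (\<exists>L. L-lipschitz_on {0..} J) \<and>
     J 0 = 1 \<and> (J \<longlongrightarrow> 0) at_top"

text \<open>For an admissible plan, the infimum over \<open>t \<ge> 0\<close> is attained and the integrand is measurable
  with values in \<open>[0, 1]\<close>.\<close>

definition W :: "(real ^ 'd) measure \<Rightarrow> (real \<Rightarrow> real) \<Rightarrow> real \<Rightarrow>
    (real \<Rightarrow> real \<Rightarrow> real ^ 'd) \<Rightarrow> real ^ 'd \<Rightarrow> real" where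
  "W \<mu> J \<epsilon> chi x =
     (LINT \<theta>|lebesgue_on (Theta \<mu>). J ((INF t\<in>{0..}. norm (chi \<theta> t - x)) / \<epsilon>))"

text \<open>\<open>w\<close> to the power \<open>\<alpha> - 1\<close> for \<open>w \<ge> 0\<close> and \<open>\<alpha> \<le> 1\<close>, with values in \<open>[0, \<infinity>]\<close>. The case
  \<open>w = 0\<close> is separate because \<open>0 powr a = 0\<close>.\<close>

definition power_am1 :: "real \<Rightarrow> real \<Rightarrow> ennreal" where
  "power_am1 \<alpha> w = (if w = 0 then (if \<alpha> < 1 then \<infinity> else 1) else ennreal (w powr (\<alpha> - 1)))"

definition cost :: "(real ^ 'd) measure \<Rightarrow> (real \<Rightarrow> real) \<Rightarrow> real \<Rightarrow> real \<Rightarrow>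
    (real \<Rightarrow> real \<Rightarrow> real ^ 'd) \<Rightarrow> ennreal" where
  "cost \<mu> J \<alpha> \<epsilon> chi =
     (\<integral>\<^sup>+\<theta>. (\<integral>\<^sup>+t. power_am1 \<alpha> (W \<mu> J \<epsilon> chi (chi \<theta> t)) * ennreal (speed (chi \<theta>) t)
        \<partial>lebesgue_on {0..}) \<partial>lebesgue_on (Theta \<mu>))"

end

theory Submission
  imports Defs
begin

text \<open>
  Up to a null set an arc-length parameterized path has speed \<open>1\<close> while it still moves and \<open>0\<close> afterwards,
  and a limit path that moves after time \<open>t\<close> is approached by paths that move after \<open>t\<close>. Since the limit
  path has speed at most \<open>1\<close> almost everywhere, lower semicontinuity of the speed holds pointwise, and
  Fatou's lemma in \<open>t\<close> and in \<open>\<theta>\<close> reduces the theorem to the upper semicontinuity of the mollified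
  multiplicity \<^const>\<open>W\<close> along converging plans and points. That is where the bound on the mean
  stopping time enters: convergence only controls the paths on bounded time intervals, but by Markov's
  inequality the set of paths that still move after a late time is small, uniformly in \<open>n\<close>.
\<close>

subsection \<open>Differentiability of Lipschitz curves\<close>

text \<open>\<open>speed\<close> is the norm of \<open>vector_derivative\<close>, which is
  unspecified where the path has no derivative. Even the bound of the speed by the Lipschitz
  constant therefore rests on almost everywhere differentiability, which is proved for curves
  through monotone Lipschitz functions of one real variable.

  The multiplicity is delicate in one direction only: the distance from a point to a path is an
  infimum over all times, so a late excursion of an approximating path, invisible on bounded time
  intervals, can only shorten that distance and enlarge \<open>W\<close>. Since the power is
  non-increasing, this is the direction in which the cost could drop.

  Fatou's lemma needs measurable integrands for the approximating plans. Replacing their speed by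
  the indicator of \<open>moves_after\<close> settles this: it is decided by the position at time t
  and countably many others, and no measurability of a derivative has to be discussed. Plans are
  assumed measurable for the completed planar measure only, so joint measurability in the sense of
  iterated integrals is first regained from continuity in time.\<close>

lemma Vitali_covering_intervals:
  fixes S U :: "real set"
  assumes "open U" "S \<subseteq> U"
    and fine: "\<And>x d. \<lbrakk>x \<in> S; 0 < d\<rbrakk> \<Longrightarrow> \<exists>a b. a < x \<and> x < b \<and> b - a < d \<and> P a b"
  obtains D where "countable D" "\<And>a b. (a, b) \<in> D \<Longrightarrow> a < b \<and> P a b \<and> {a..b} \<subseteq> U"
    "disjoint_family_on (\<lambda>(a, b). {a..b}) D"
    "negligible (S - (\<Union>(a, b)\<in>D. {a<..<b}))"
proof -
  define K where "K = {(a, b). a < b \<and> P a b \<and> {a..b} \<subseteq> U}"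
  \<comment> \<open>Midpoint and half-length turn an interval into a closed ball, the form in which
    Vitali's theorem is applied.\<close>
  define c where "c = (\<lambda>(a::real, b). (a + b) / 2)"
  define r where "r = (\<lambda>(a::real, b). (b - a) / 2)"
  have cball: "cball (c i) (r i) = (case i of (a, b) \<Rightarrow> {a..b})" for i
  proof (cases i)
    case (Pair a b)
    have "(a + b) / 2 - (b - a) / 2 = a" "(a + b) / 2 + (b - a) / 2 = b"
      by (simp_all add: field_simps)
    then show ?thesis
      by (simp add: Pair c_def r_def cball_eq_atLeastAtMost)
  qed
  have r: "0 < r i" if "i \<in> K" for i
    using that by (auto simp: K_def r_def)
  have cover: "\<exists>i. i \<in> K \<and> x \<in> cball (c i) (r i) \<and> r i < d" if x: "x \<in> S" "0 < d" for x d
  proof -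
    obtain e where e: "e > 0" "ball x e \<subseteq> U"
      using openE[OF assms(1) subsetD[OF assms(2) x(1)]] by blast
    obtain a b where ab: "a < x" "x < b" "b - a < min d e" "P a b"
      using fine[OF \<open>x \<in> S\<close>, of "min d e"] e x by auto
    have "{a..b} \<subseteq> ball x e"
      using ab by (auto simp: dist_real_def)
    then have "(a, b) \<in> K"
      using ab e by (auto simp: K_def)
    then show ?thesis
      using ab by (intro exI[of _ "(a, b)"]) (auto simp: cball, auto simp: r_def)
  qed
  obtain D where D: "countable D" "D \<subseteq> K"
     "pairwise (\<lambda>i j. disjnt (cball (c i) (r i)) (cball (c j) (r j))) D"
     "negligible (S - (\<Union>i \<in> D. cball (c i) (r i)))"
    by (rule Vitali_covering_theorem_cballs[of K r S c, OF r cover])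
  \<comment> \<open>Passing to open intervals costs only countably many endpoints. Open intervals
    have an open union, inside which a second covering can be chosen; disjointness is kept for the
    closed ones.\<close>
  have "countable (\<Union>(a, b)\<in>D. {a, b})"
    using D(1) by auto
  then have "negligible (S - (\<Union>i \<in> D. cball (c i) (r i)) \<union> (\<Union>(a, b)\<in>D. {a, b}))"
    by (intro negligible_Un[OF D(4)])
       (simp add: negligible_iff_null_sets null_sets_completionI countable_imp_null_set_lborel)
  then have "negligible (S - (\<Union>(a, b)\<in>D. {a<..<b}))"
    by (rule negligible_subset) (fastforce simp: cball)
  moreover have "disjoint_family_on (\<lambda>(a, b). {a..b}) D"
    using D(3) by (auto simp: cball disjoint_family_on_def pairwise_def disjnt_def)
  ultimately show ?thesis
    using D that[of D] by (auto simp: K_def)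
qed

text \<open>Straddling intervals \<open>a < x < b\<close> instead of one-sided ones make the derivate sets countable
  intersections of open sets.\<close>

lemma borel_interval_limit_set:
  fixes P :: "real \<Rightarrow> real \<Rightarrow> bool"
  shows "{x. \<forall>d>0. \<exists>a b. a < x \<and> x < b \<and> b - a < d \<and> P a b} \<in> sets borel" (is "?X \<in> _")
proof -
  define U where "U k = (\<Union>(a, b)\<in>{(a, b). b - a < inverse (real (Suc k)) \<and> P a b}. {a<..<b})" for k
  have "?X = (\<Inter>k. U k)"
  proof (intro set_eqI iffI INT_I CollectI allI impI)
    fix x k assume "x \<in> ?X"
    then have *: "d > 0 \<Longrightarrow> \<exists>a b. a < x \<and> x < b \<and> b - a < d \<and> P a b" for d
      by blast
    have "inverse (real (Suc k)) > 0"
      by simp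
    from *[OF this] obtain a b where "a < x" "x < b" "b - a < inverse (real (Suc k))" "P a b"
      by blast
    then show "x \<in> U k"
      unfolding U_def by (intro UN_I[of "(a, b)"]) auto
  next
    fix x d :: real assume x: "x \<in> (\<Inter>k. U k)" and "d > 0"
    then obtain k where k: "inverse (real (Suc k)) < d"
      using reals_Archimedean[of d] by blast
    have "x \<in> U k"
      using x by blast
    then obtain a b where "a < x" "x < b" "b - a < inverse (real (Suc k))" "P a b"
      by (auto simp: U_def)
    then show "\<exists>a b. a < x \<and> x < b \<and> b - a < d \<and> P a b"
      using k less_trans by blast
  qed
  moreover have "open (U k)" for k
    by (auto simp: U_def)
  ultimately show ?thesis
    by auto
qed

text \<open>Vitali's covering theorem is applied twice: the intervals of large slope are chosen inside the
  intervals of small slope, and the Stieltjes measure of \<open>f\<close> compares the two families.\<close>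

lemma negligible_two_slopes:
  fixes f :: "real \<Rightarrow> real"
  assumes f: "mono f" "continuous_on UNIV f" and pq: "0 < p" "p < q" and E: "E \<in> lmeasurable"
    and less: "\<And>x d. \<lbrakk>x \<in> E; d > 0\<rbrakk> \<Longrightarrow> \<exists>a b. a < x \<and> x < b \<and> b - a < d \<and> f b - f a < p * (b - a)"
    and greater: "\<And>x d. \<lbrakk>x \<in> E; d > 0\<rbrakk> \<Longrightarrow> \<exists>a b. a < x \<and> x < b \<and> b - a < d \<and> f b - f a > q * (b - a)"
  shows "negligible E"
proof -
  define \<mu> where "\<mu> = interval_measure f"
  have sets_\<mu>: "sets \<mu> = sets borel"
    by (simp add: \<mu>_def)
  have \<mu>: "emeasure \<mu> {a..b} = ennreal (f b - f a)" if "a < b" for a b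
    unfolding \<mu>_def using f that
    by (intro emeasure_interval_measure_Icc) (auto simp: mono_def)
  \<comment> \<open>Write |A| for Lebesgue measure, and D1, D2 also for the unions of their
    intervals. The chain is q |E| \<le> q |D2| \<le> \<mu>(D2) \<le> \<mu>(D1) \<le> p |D1| \<le> p
    |G| \<le> p (|E| + \<delta>). Disjointness sums the slope bounds over each family, and the union
    of D2 lies inside that of D1.\<close>
  have main: "ennreal q * emeasure lebesgue E \<le> ennreal p * (emeasure lebesgue E + ennreal \<delta>)"
    if "\<delta> > 0" for \<delta>
  proof -
    obtain G where G: "open G" "E \<subseteq> G" "G - E \<in> lmeasurable" "emeasure lebesgue (G - E) < ennreal \<delta>"
      using sets_lebesgue_outer_open[of E \<delta>] E \<open>\<delta> > 0\<close> by auto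
    obtain D1 where D1: "countable D1"
      "\<And>a b. (a, b) \<in> D1 \<Longrightarrow> a < b \<and> f b - f a < p * (b - a) \<and> {a..b} \<subseteq> G"
      "disjoint_family_on (\<lambda>(a, b). {a..b}) D1" "negligible (E - (\<Union>(a, b)\<in>D1. {a<..<b}))"
      by (rule Vitali_covering_intervals[OF G(1,2), of "\<lambda>a b. f b - f a < p * (b - a)"])
         (rule less, assumption, assumption, blast)
    define V where "V = (\<Union>(a, b)\<in>D1. {a<..<b})"
    have V: "open V"
      by (auto simp: V_def)
    obtain D2 where D2: "countable D2"
      "\<And>a b. (a, b) \<in> D2 \<Longrightarrow> a < b \<and> f b - f a > q * (b - a) \<and> {a..b} \<subseteq> V"
      "disjoint_family_on (\<lambda>(a, b). {a..b}) D2" "negligible (E \<inter> V - (\<Union>(a, b)\<in>D2. {a<..<b}))"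
      by (rule Vitali_covering_intervals[OF V, of "E \<inter> V" "\<lambda>a b. f b - f a > q * (b - a)"])
         (rule Int_lower2, rule greater, erule IntD1, assumption, blast)
    have meas: "(\<Union>(a, b)\<in>D. {a..b}) \<in> sets borel" if "countable D" for D :: "(real \<times> real) set"
      using that by (intro sets.countable_UN'') auto
    have UN: "emeasure M (\<Union>(a, b)\<in>D. {a..b}) = (\<integral>\<^sup>+i. emeasure M {fst i..snd i} \<partial>count_space D)"
      if "countable D" "disjoint_family_on (\<lambda>(a, b). {a..b}) D" "sets M = sets borel"
      for D and M :: "real measure"
    proof -
      have "(case i of (a, b) \<Rightarrow> {a..b}) \<in> sets M" for i :: "real \<times> real"
        by (simp add: that(3) split: prod.split)
      from emeasure_UN_countable[OF this that(1,2)] show ?thesis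
        by (simp add: split_def)
    qed
    have neg: "negligible (E - (\<Union>(a, b)\<in>D2. {a<..<b}))"
      using negligible_Un[OF D1(4)[folded V_def] D2(4)] by (rule negligible_subset) blast
    have Ioo: "(\<Union>(a, b)\<in>D. {a<..<b}) \<subseteq> (\<Union>(a, b)\<in>D. {a..b})" for D :: "(real \<times> real) set"
      by (intro UN_mono) auto
    have "(\<Union>(a, b)\<in>D2. {a..b}) \<subseteq> V"
      using D2(2) by (intro UN_least) auto
    also have "V \<subseteq> (\<Union>(a, b)\<in>D1. {a..b})"
      unfolding V_def by (rule Ioo)
    finally have D21: "(\<Union>(a, b)\<in>D2. {a..b}) \<subseteq> (\<Union>(a, b)\<in>D1. {a..b})" .
    have D1G: "(\<Union>(a, b)\<in>D1. {a..b}) \<subseteq> G"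
      using D1(2) by (intro UN_least) auto
    have meas': "(\<Union>(a, b)\<in>D. {a..b}) \<in> sets lebesgue" if "countable D" for D :: "(real \<times> real) set"
      using meas[OF that] by simp
    have leb: "emeasure lebesgue (\<Union>(a, b)\<in>D. {a..b}) = emeasure lborel (\<Union>(a, b)\<in>D. {a..b})"
      if "countable D" for D :: "(real \<times> real) set"
      using meas[OF that] by simp
    have "emeasure lebesgue E \<le> emeasure lebesgue ((\<Union>(a, b)\<in>D2. {a..b}) \<union> (E - (\<Union>(a, b)\<in>D2. {a<..<b})))"
      using Ioo[of D2] by (intro emeasure_mono sets.Un meas' D2(1) negligible_imp_sets[OF neg]) blast
    also have "\<dots> = emeasure lborel (\<Union>(a, b)\<in>D2. {a..b})"
      using neg[unfolded negligible_iff_null_sets] unfolding leb[OF D2(1), symmetric]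
      by (rule emeasure_Un_null_set[OF meas'[OF D2(1)]])
    finally have E_le: "emeasure lebesgue E \<le> emeasure lborel (\<Union>(a, b)\<in>D2. {a..b})" .
    have "emeasure lborel (\<Union>(a, b)\<in>D1. {a..b}) \<le> emeasure lebesgue (E \<union> (G - E))"
      unfolding leb[OF D1(1), symmetric]
      using D1G G(2) by (intro emeasure_mono sets.Un fmeasurableD[OF E] fmeasurableD[OF G(3)]) blast
    also have "\<dots> \<le> emeasure lebesgue E + emeasure lebesgue (G - E)"
      using E G by (intro emeasure_subadditive) auto
    also have "\<dots> \<le> emeasure lebesgue E + ennreal \<delta>"
      using G by (intro add_mono) auto
    finally have D1_le: "emeasure lborel (\<Union>(a, b)\<in>D1. {a..b}) \<le> emeasure lebesgue E + ennreal \<delta>" .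
    have "ennreal q * emeasure lebesgue E \<le> ennreal q * emeasure lborel (\<Union>(a, b)\<in>D2. {a..b})"
      by (intro mult_left_mono E_le) simp
    also have "\<dots> = (\<integral>\<^sup>+i. ennreal (q * (snd i - fst i)) \<partial>count_space D2)"
      unfolding UN[OF D2(1,3) sets_lborel]
      by (subst nn_integral_cmult[symmetric])
         (use D2(2) pq in \<open>fastforce intro!: nn_integral_cong simp: ennreal_mult less_imp_le\<close>)+
    also have "\<dots> \<le> (\<integral>\<^sup>+i. emeasure \<mu> {fst i..snd i} \<partial>count_space D2)"
      by (intro nn_integral_mono) (use D2(2) in \<open>force simp: \<mu> intro!: ennreal_leI\<close>)
    also have "\<dots> = emeasure \<mu> (\<Union>(a, b)\<in>D2. {a..b})"
      by (simp add: UN[OF D2(1,3) sets_\<mu>])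
    also have "\<dots> \<le> emeasure \<mu> (\<Union>(a, b)\<in>D1. {a..b})"
      using meas[OF D1(1)] by (intro emeasure_mono D21) (simp add: sets_\<mu>)
    also have "\<dots> = (\<integral>\<^sup>+i. emeasure \<mu> {fst i..snd i} \<partial>count_space D1)"
      by (simp add: UN[OF D1(1,3) sets_\<mu>])
    also have "\<dots> \<le> (\<integral>\<^sup>+i. ennreal (p * (snd i - fst i)) \<partial>count_space D1)"
      by (intro nn_integral_mono) (use D1(2) in \<open>force simp: \<mu> intro!: ennreal_leI\<close>)
    also have "\<dots> = ennreal p * emeasure lborel (\<Union>(a, b)\<in>D1. {a..b})"
      unfolding UN[OF D1(1,3) sets_lborel]
      by (subst nn_integral_cmult[symmetric])
         (use D1(2) pq in \<open>fastforce intro!: nn_integral_cong simp: ennreal_mult less_imp_le\<close>)+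
    also have "\<dots> \<le> ennreal p * (emeasure lebesgue E + ennreal \<delta>)"
      by (intro mult_left_mono D1_le) simp
    finally show ?thesis .
  qed
  \<comment> \<open>\<open>E\<close> has finite measure, so the inequality passes to real numbers,
    where \<delta> tending to 0 leaves (q - p) * s \<le> 0.\<close>
  define s where "s = measure lebesgue E"
  have s: "emeasure lebesgue E = ennreal s" "s \<ge> 0"
    using emeasure_eq_measure2[OF E] by (simp_all add: s_def)
  have "q * s \<le> p * (s + \<delta>)" if "\<delta> > 0" for \<delta>
  proof -
    have "ennreal (q * s) \<le> ennreal (p * (s + \<delta>))"
      using main[OF that] s that pq by (simp add: ennreal_mult)
    then show ?thesis
      using s that pq by (subst (asm) ennreal_le_iff) simp_all
  qed
  then have "(q - p) * s \<le> \<epsilon>" if "\<epsilon> > 0" for \<epsilon>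
    using \<open>\<And>\<delta>. \<delta> > 0 \<Longrightarrow> q * s \<le> p * (s + \<delta>)\<close>[of "\<epsilon> / p"] that pq(1) by (simp add: algebra_simps)
  then have "(q - p) * s \<le> 0"
    using field_le_epsilon[of "(q - p) * s" 0] by simp
  then have "s = 0"
    using s pq by (simp add: mult_le_0_iff)
  then show ?thesis
    using s E by (auto simp: negligible_iff_null_sets)
qed

text \<open>Intersecting with compact intervals supplies the finite measure that the two-slope
  estimate needs. If p \<le> 0, a monotone function has no slope below p and the first set is
  empty.\<close>

lemma negligible_distinct_derivates:
  fixes f :: "real \<Rightarrow> real"
  assumes f: "mono f" "continuous_on UNIV f" and pq: "p < q"
  shows "negligible ({x. \<forall>d>0. \<exists>a b. a < x \<and> x < b \<and> b - a < d \<and> f b - f a < p * (b - a)} \<inter>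
    {x. \<forall>d>0. \<exists>a b. a < x \<and> x < b \<and> b - a < d \<and> f b - f a > q * (b - a)})"
    (is "negligible (?A \<inter> ?B)")
proof (cases "p > 0")
  case False
  have "p * (b - a) \<le> f b - f a" if "a < b" for a b
    using False monoD[OF f(1), of a b] that mult_nonpos_nonneg[of p "b - a"] by linarith
  then have "?A = {}"
  proof (intro equals0I)
    fix x assume "x \<in> ?A"
    then obtain a b where "a < x" "x < b" "f b - f a < p * (b - a)"
      using zero_less_one[where 'a=real] by blast
    with \<open>\<And>a b. a < b \<Longrightarrow> p * (b - a) \<le> f b - f a\<close>[of a b] show False
      by linarith
  qed
  then show ?thesis
    by (simp only: Int_empty_left negligible_empty)
next
  case True
  have "negligible (?A \<inter> ?B \<inter> cbox l u)" (is "negligible ?E") for l u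
  proof (rule negligible_two_slopes[OF f True pq])
    have "?E \<in> sets borel"
      by (intro sets.Int borel_interval_limit_set) auto
    then show "?E \<in> lmeasurable"
      by (intro bounded_set_imp_lmeasurable) (auto intro: bounded_Int)
  qed blast+
  then show ?thesis
    by (subst negligible_on_intervals) blast
qed

text \<open>By continuity one endpoint of a straddling interval can be moved into x, which turns the
  two-sided slope bounds into bounds for ordinary difference quotients.\<close>

lemma has_field_derivative_of_slope_bounds:
  fixes f :: "real \<Rightarrow> real"
  assumes cont: "isCont f x"
    and slope: "\<And>e. e > 0 \<Longrightarrow> \<exists>d>0. \<forall>a b. a < x \<longrightarrow> x < b \<longrightarrow> b - a < d \<longrightarrow>
      \<bar>f b - f a - D * (b - a)\<bar> \<le> e * (b - a)"
  shows "(f has_field_derivative D) (at x)"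
proof -
  have "\<exists>d>0. \<forall>y. \<bar>y - x\<bar> < d \<longrightarrow> \<bar>f y - f x - D * (y - x)\<bar> \<le> e * \<bar>y - x\<bar>" if e: "e > 0" for e
  proof -
    obtain d where d: "d > 0" and bound: "\<And>a b. \<lbrakk>a < x; x < b; b - a < d\<rbrakk> \<Longrightarrow>
      \<bar>f b - f a - D * (b - a)\<bar> \<le> e * (b - a)"
      using slope[OF e] by blast
    have right: "\<bar>f y - f x - D * (y - x)\<bar> \<le> e * (y - x)" if y: "x < y" "y - x < d" for y
    proof (rule tendsto_le[of "at_left x"])
      show "((\<lambda>a. e * (y - a)) \<longlongrightarrow> e * (y - x)) (at_left x)"
        by (intro tendsto_intros)
      show "((\<lambda>a. \<bar>f y - f a - D * (y - a)\<bar>) \<longlongrightarrow> \<bar>f y - f x - D * (y - x)\<bar>) (at_left x)"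
        using cont by (intro tendsto_intros) (auto simp: isCont_def filterlim_at_split)
      have "\<forall>\<^sub>F a in at_left x. a \<in> {y - d<..<x}"
        using y by (intro eventually_at_left_real) auto
      then show "\<forall>\<^sub>F a in at_left x. \<bar>f y - f a - D * (y - a)\<bar> \<le> e * (y - a)"
        by eventually_elim (use y in \<open>auto intro: bound\<close>)
    qed simp
    have left: "\<bar>f x - f y - D * (x - y)\<bar> \<le> e * (x - y)" if y: "y < x" "x - y < d" for y
    proof (rule tendsto_le[of "at_right x"])
      show "((\<lambda>b. e * (b - y)) \<longlongrightarrow> e * (x - y)) (at_right x)"
        by (intro tendsto_intros)
      show "((\<lambda>b. \<bar>f b - f y - D * (b - y)\<bar>) \<longlongrightarrow> \<bar>f x - f y - D * (x - y)\<bar>) (at_right x)"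
        using cont by (intro tendsto_intros) (auto simp: isCont_def filterlim_at_split)
      have "\<forall>\<^sub>F b in at_right x. b \<in> {x<..<y + d}"
        using y by (intro eventually_at_right_real) auto
      then show "\<forall>\<^sub>F b in at_right x. \<bar>f b - f y - D * (b - y)\<bar> \<le> e * (b - y)"
        by eventually_elim (use y in \<open>auto intro: bound\<close>)
    qed simp
    have "\<bar>f y - f x - D * (y - x)\<bar> \<le> e * \<bar>y - x\<bar>" if "\<bar>y - x\<bar> < d" for y
      using that left[of y] right[of y] by (cases y x rule: linorder_cases) (auto simp: algebra_simps)
    with d show ?thesis
      by blast
  qed
  then show ?thesis
    unfolding has_field_derivative_def has_derivative_at_alt by (simp add: bounded_linear_mult_right)
qed

text \<open>The exceptional set \<open>N\<close> is a countable union over rational pairs p < q.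
  Outside it no rational pair separates the lower from the upper derivate, so the two agree;
  monotonicity and the Lipschitz bound keep the common value finite.\<close>

lemma negligible_not_differentiable_mono_lipschitz:
  fixes f :: "real \<Rightarrow> real"
  assumes f: "mono f" and lip: "K-lipschitz_on UNIV f"
  shows "negligible {x. \<not> f differentiable (at x)}"
proof -
  have cont: "continuous_on UNIV f"
    using lip by (rule lipschitz_on_continuous_on)
  define L where "L p = {x. \<forall>d>0. \<exists>a b. a < x \<and> x < b \<and> b - a < d \<and> f b - f a < p * (b - a)}" for p
  define G where "G q = {x. \<forall>d>0. \<exists>a b. a < x \<and> x < b \<and> b - a < d \<and> f b - f a > q * (b - a)}" for q
  define N where "N = (\<Union>(p, q)\<in>{(p, q). p \<in> \<rat> \<and> q \<in> \<rat> \<and> p < q}. L p \<inter> G q)"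
  have "countable {(p, q). p \<in> \<rat> \<and> q \<in> \<rat> \<and> p < (q::real)}"
    by (rule countable_subset[of _ "\<rat> \<times> \<rat>"]) (auto simp: countable_rat)
  moreover have "negligible (L p \<inter> G q)" if "p < q" for p q
    unfolding L_def G_def by (rule negligible_distinct_derivates[OF f cont that])
  ultimately have "negligible N"
    unfolding N_def
    by (intro negligible_countable_Union[of "(\<lambda>(p, q). L p \<inter> G q) ` _"]) auto
  moreover have "f differentiable (at x)" if x: "x \<notin> N" for x
  proof -
    have slope_nonneg: "0 \<le> f b - f a" if "a < b" for a b
      using monoD[OF f, of a b] that by simp
    have slope_le: "f b - f a \<le> K * (b - a)" if "a < b" for a b
      using lipschitz_onD[OF lip, of b a] slope_nonneg[OF that] that by (simp add: dist_real_def)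
    have L_up: "x \<in> L p'" if p: "x \<in> L p" "p \<le> p'" for p p'
      unfolding L_def
    proof (intro CollectI allI impI)
      fix d :: real assume "d > 0"
      then obtain a b where ab: "a < x" "x < b" "b - a < d" "f b - f a < p * (b - a)"
        using p(1) unfolding L_def by blast
      have "p * (b - a) \<le> p' * (b - a)"
        using ab p(2) by (intro mult_right_mono) auto
      with ab show "\<exists>a b. a < x \<and> x < b \<and> b - a < d \<and> f b - f a < p' * (b - a)"
        by (intro exI[of _ a] exI[of _ b]) linarith
    qed
    have "x \<in> L (K + 1)"
      unfolding L_def
    proof (intro CollectI allI impI)
      fix d :: real assume "d > 0"
      then show "\<exists>a b. a < x \<and> x < b \<and> b - a < d \<and> f b - f a < (K + 1) * (b - a)"
        using slope_le[of "x - d / 4" "x + d / 4"]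
        by (intro exI[of _ "x - d / 4"] exI[of _ "x + d / 4"]) (auto simp: algebra_simps)
    qed
    moreover have bdd: "0 \<le> p" if p: "x \<in> L p" for p
    proof -
      obtain a b where ab: "a < x" "x < b" "f b - f a < p * (b - a)"
        using p zero_less_one[where 'a=real] unfolding L_def by blast
      then have "0 < p * (b - a)"
        using slope_nonneg[of a b] by simp
      then show ?thesis
        using ab by (auto simp: zero_less_mult_iff)
    qed
    ultimately have ne: "{p. x \<in> L p} \<noteq> {}" and bb: "bdd_below {p. x \<in> L p}"
      by (auto intro!: bdd_belowI[of _ 0])
    \<comment> \<open>The lower derivate at x, that is, the lower limit of the slopes over short
      intervals around x.\<close>
    define D where "D = Inf {p. x \<in> L p}"
    have "(f has_field_derivative D) (at x)"
    proof (rule has_field_derivative_of_slope_bounds)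
      show "isCont f x"
        using cont by (simp add: continuous_on_eq_continuous_at)
      fix e :: real assume e: "e > 0"
      have "x \<notin> L (D - e)"
        using cInf_lower[OF _ bb, of "D - e"] e by (auto simp: D_def)
      then obtain d1 where d1: "d1 > 0" "\<And>a b. \<lbrakk>a < x; x < b; b - a < d1\<rbrakk> \<Longrightarrow> (D - e) * (b - a) \<le> f b - f a"
        unfolding L_def by (simp add: not_less) (metis linorder_not_le)
      obtain p where p: "x \<in> L p" "p < D + e / 2"
        using cInf_lessD[OF ne, of "D + e / 2"] e by (auto simp: D_def)
      \<comment> \<open>\<open>N\<close> only involves rational pairs, so D + e / 2 is enclosed by
        rationals p' < q'. Slopes below p' occur at every scale; as x is outside \<open>N\<close>,
        slopes above q' do not, and q' < D + e gives the upper bound.\<close>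
      obtain p' where p': "p' \<in> \<rat>" "p < p'" "p' < D + e / 2"
        using Rats_dense_in_real[OF p(2)] by blast
      moreover obtain q' where q': "q' \<in> \<rat>" "D + e / 2 < q'" "q' < D + e"
        using Rats_dense_in_real[of "D + e / 2" "D + e"] e by auto
      ultimately have pq: "p' \<in> \<rat>" "q' \<in> \<rat>" "p < p'" "p' < q'" "q' < D + e"
        by auto
      have "x \<in> L p'"
        using L_up[OF p(1)] pq by simp
      then have "x \<notin> G q'"
        using x pq by (auto simp: N_def)
      then obtain d2 where d2: "d2 > 0" "\<And>a b. \<lbrakk>a < x; x < b; b - a < d2\<rbrakk> \<Longrightarrow> f b - f a \<le> q' * (b - a)"
        unfolding G_def by (simp add: not_less) (metis linorder_not_le)
      have "\<bar>f b - f a - D * (b - a)\<bar> \<le> e * (b - a)" if "a < x" "x < b" "b - a < min d1 d2" for a b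
      proof -
        have "q' * (b - a) \<le> (D + e) * (b - a)"
          using pq that by (intro mult_right_mono) auto
        then show ?thesis
          using d1(2)[of a b] d2(2)[of a b] that by (simp add: algebra_simps abs_le_iff)
      qed
      then show "\<exists>d>0. \<forall>a b. a < x \<longrightarrow> x < b \<longrightarrow> b - a < d \<longrightarrow> \<bar>f b - f a - D * (b - a)\<bar> \<le> e * (b - a)"
        using d1(1) d2(1) by (intro exI[of _ "min d1 d2"]) auto
    qed
    then show ?thesis
      by (auto simp: real_differentiable_def)
  qed
  ultimately show ?thesis
    by - (rule negligible_subset, assumption, auto)
qed

text \<open>A coordinate of g varies by at most K times the elapsed parameter, so adding K * x makes
  it monotone, with Lipschitz constant 2 K, and does not affect differentiability. The null sets of
  the finitely many coordinates are then united.\<close>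

lemma Rademacher_curve:
  fixes g :: "real \<Rightarrow> 'a::euclidean_space"
  assumes g: "K-lipschitz_on UNIV g"
  shows "negligible {x. \<not> g differentiable (at x)}"
proof -
  have comp: "negligible {x. \<not> (\<lambda>x. g x \<bullet> i) differentiable (at x)}" if i: "i \<in> Basis" for i
  proof -
    define f where "f x = g x \<bullet> i + K * x" for x
    have lip: "K-lipschitz_on UNIV (\<lambda>x. g x \<bullet> i)"
    proof (rule lipschitz_onI)
      show "0 \<le> K"
        using g by (rule lipschitz_on_nonneg)
      fix x y
      have "dist (g x \<bullet> i) (g y \<bullet> i) \<le> dist (g x) (g y)"
        using Basis_le_norm[OF i, of "g x - g y"] by (simp add: dist_norm inner_diff_left)
      then show "dist (g x \<bullet> i) (g y \<bullet> i) \<le> K * dist x y"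
        using lipschitz_onD[OF g, of x y] by simp
    qed
    have "mono f"
    proof (rule monoI)
      fix x y :: real assume "x \<le> y"
      then show "f x \<le> f y"
        using lipschitz_onD[OF lip, of x y] by (auto simp: f_def dist_real_def algebra_simps abs_le_iff)
    qed
    moreover have "(K + K)-lipschitz_on UNIV f"
      unfolding f_def
    proof (intro lipschitz_on_add lip lipschitz_onI)
      show "0 \<le> K"
        using g by (rule lipschitz_on_nonneg)
      then show "dist (K * x) (K * y) \<le> K * dist x y" for x y
        by (simp add: dist_real_def abs_mult flip: right_diff_distrib)
    qed
    ultimately have "negligible {x. \<not> f differentiable (at x)}"
      by (rule negligible_not_differentiable_mono_lipschitz)
    moreover have "(\<lambda>x. g x \<bullet> i) differentiable (at x)" if "f differentiable (at x)" for x
    proof -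
      have "(\<lambda>x. f x - K * x) differentiable (at x)"
        using that by (intro derivative_intros)
      then show ?thesis
        by (simp add: f_def)
    qed
    ultimately show ?thesis
      by - (rule negligible_subset, assumption, auto)
  qed
  have "negligible (\<Union>i\<in>Basis. {x. \<not> (\<lambda>x. g x \<bullet> i) differentiable (at x)})"
    using comp by (intro negligible_Union) auto
  then show ?thesis
    by (rule negligible_subset) (use differentiable_componentwise_within[of g] in auto)
qed

lemma norm_vector_derivative_le_lipschitz:
  assumes g: "K-lipschitz_on UNIV g" and D: "(g has_vector_derivative v) (at x)"
  shows "norm v \<le> K"
proof -
  have "norm v \<le> K + e" if e: "e > 0" for e
  proof -
    obtain d where d: "d > 0" "\<And>y. norm (y - x) < d \<Longrightarrow> norm (g y - g x - (y - x) *\<^sub>R v) \<le> e * norm (y - x)"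
      using D e unfolding has_vector_derivative_def has_derivative_at_alt by blast
    define y where "y = x + d / 2"
    have y: "y - x = d / 2" "norm (y - x) < d"
      using d(1) by (auto simp: y_def)
    have "norm ((y - x) *\<^sub>R v) \<le> norm (g y - g x) + norm (g y - g x - (y - x) *\<^sub>R v)"
      using norm_triangle_ineq4[of "g y - g x" "g y - g x - (y - x) *\<^sub>R v"] by simp
    also have "\<dots> \<le> K * (d / 2) + e * (d / 2)"
      using lipschitz_onD[OF g, of y x] d(2)[OF y(2)] d(1) by (intro add_mono) (simp_all add: dist_norm y(1))
    finally have "(d / 2) * norm v \<le> (d / 2) * (K + e)"
      using d(1) y by (simp add: algebra_simps)
    then show ?thesis
      using d(1) by (simp add: mult_le_cancel_left_pos)
  qed
  then show ?thesis
    by (rule field_le_epsilon)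
qed

lemma at_within_atLeast: "a < t \<Longrightarrow> at t within {a..} = at (t::real)"
  by (rule at_within_interior) (simp add: interior_real_atLeast)

lemma AE_speed_le_lipschitz:
  assumes "K-lipschitz_on {0..} \<gamma>"
  shows "AE t in lebesgue_on {0..}. speed \<gamma> t \<le> K"
proof -
  \<comment> \<open>Constant extension to the left gives a Lipschitz curve on the whole line that
    agrees with \<gamma> near every t > 0, where the derivative within \<open>{0..}\<close> is the
    ordinary one.\<close>
  define g where "g t = \<gamma> (max 0 t)" for t
  have g: "K-lipschitz_on UNIV g"
  proof (rule lipschitz_onI)
    show "0 \<le> K"
      using assms by (rule lipschitz_on_nonneg)
    fix x y :: real
    have "dist (g x) (g y) \<le> K * dist (max 0 x) (max 0 y)"
      unfolding g_def by (rule lipschitz_onD[OF assms]) auto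
    also have "\<dots> \<le> K * dist x y"
      using \<open>0 \<le> K\<close> by (intro mult_left_mono) (auto simp: dist_real_def)
    finally show "dist (g x) (g y) \<le> K * dist x y" .
  qed
  have "speed \<gamma> t \<le> K" if t: "t > 0" "g differentiable (at t)" for t
  proof -
    obtain v where v: "(g has_vector_derivative v) (at t)"
      using t(2) vector_derivative_works by blast
    then have "(\<gamma> has_vector_derivative v) (at t)"
      by (rule has_vector_derivative_transform_within_open[of _ _ _ "{0<..}"]) (use t in \<open>auto simp: g_def\<close>)
    then have "vector_derivative \<gamma> (at t within {0..}) = v"
      using t(1) by (simp add: at_within_atLeast vector_derivative_at)
    then show ?thesis
      using norm_vector_derivative_le_lipschitz[OF g v] by (simp add: speed_def)
  qed
  moreover have "AE t in lebesgue. t \<notin> {x. \<not> g differentiable (at x)}"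
    using Rademacher_curve[OF g] by (intro AE_not_in) (simp add: negligible_iff_null_sets)
  moreover have "AE t in lebesgue. t \<noteq> 0"
    by (rule AE_I[of _ _ "{0}"]) auto
  ultimately show ?thesis
    by (subst AE_restrict_space_iff) (auto elim!: eventually_elim2)
qed

lemma speed_eq_0_of_const:
  assumes "t > 0" "open U" "t \<in> U" "\<And>s. s \<in> U \<Longrightarrow> \<gamma> s = c"
  shows "speed \<gamma> t = 0"
proof -
  have "((\<lambda>_. c) has_vector_derivative 0) (at t)"
    by (rule has_vector_derivative_const)
  then have "(\<gamma> has_vector_derivative 0) (at t)"
    by (rule has_vector_derivative_transform_within_open[OF _ assms(2,3)]) (simp add: assms(4))
  then have "vector_derivative \<gamma> (at t within {0..}) = 0"
    using assms(1) by (simp add: at_within_atLeast vector_derivative_at)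
  then show ?thesis
    by (simp add: speed_def)
qed

subsection \<open>Measurability of plans\<close>

text \<open>A set that is null in the plane can have a non-measurable section, so only almost every
  time can be reached: a Borel representative has measurable sections, and by Fubini almost every
  section of the exceptional null set is null.\<close>

lemma AE_section_measurable:
  fixes f :: "real \<times> real \<Rightarrow> 'b::euclidean_space"
  assumes f: "f \<in> borel_measurable (lebesgue_on (S \<times> T))"
    and [measurable]: "S \<in> sets borel" "T \<in> sets borel"
  shows "AE t in lborel. t \<in> T \<longrightarrow> (\<lambda>\<theta>. f (\<theta>, t)) \<in> borel_measurable (lebesgue_on S)"
proof -
  have "AE t in lborel. t \<in> T \<longrightarrow> (\<lambda>\<theta>. f (\<theta>, t) \<bullet> i) \<in> borel_measurable (lebesgue_on S)" for i
  proof -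
    \<comment> \<open>One coordinate, extended by 0, is a real function on the whole plane and
      agrees almost everywhere with a Borel function \<open>g\<close>.\<close>
    define h where "h z = (if z \<in> S \<times> T then f z \<bullet> i else 0)" for z
    have "S \<times> T \<in> sets (borel \<Otimes>\<^sub>M borel)"
      by measurable
    then have "S \<times> T \<in> sets borel"
      unfolding borel_prod .
    then have ST: "S \<times> T \<in> sets lebesgue"
      by (intro sets_completionI_sets) simp
    have "h \<in> borel_measurable lebesgue"
      unfolding h_def using f by (intro borel_measurable_if_I[OF _ ST]) (rule borel_measurable_inner, simp_all)
    from completion_ex_borel_measurable_real[OF this]
    obtain g where g: "g \<in> borel_measurable lborel" and hg: "AE z in lborel. h z = g z"
      by blast
    obtain N where N: "N \<in> null_sets lborel" "{z. h z \<noteq> g z} \<subseteq> N"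
      using hg by (auto simp: eventually_ae_filter)
    have hgN: "h z = g z" if "z \<notin> N" for z
      using N(2) that by blast
    have "AE z in lborel \<Otimes>\<^sub>M lborel. z \<notin> N"
      using N(1) by (intro AE_not_in) (simp add: lborel_prod)
    then have "AE \<theta> in lborel. AE t in lborel. (\<theta>, t) \<notin> N"
      by (rule lborel_pair.AE_pair)
    \<comment> \<open>Fixed times are wanted, not fixed \<theta>. The exchange is made for the
      complement of the Borel set \<open>N\<close>; the set where h and g agree is not known to be
      Borel.\<close>
    then have "AE t in lborel. AE \<theta> in lborel. (\<theta>, t) \<notin> N"
    proof (subst (asm) lborel_pair.AE_commute)
      have "N \<in> sets (lborel \<Otimes>\<^sub>M lborel)"
        using null_setsD2[OF N(1)] by (simp only: lborel_prod)
      then have "space (lborel \<Otimes>\<^sub>M lborel) - N \<in> sets (lborel \<Otimes>\<^sub>M lborel)"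
        by (rule sets.compl_sets)
      also have "space (lborel \<Otimes>\<^sub>M lborel) - N = {x \<in> space (lborel \<Otimes>\<^sub>M lborel). (fst x, snd x) \<notin> N}"
        by auto
      finally show "\<dots> \<in> sets (lborel \<Otimes>\<^sub>M lborel)" .
    qed
    then show ?thesis
    proof eventually_elim
      case (elim t)
      show ?case
      proof
        assume t: "t \<in> T"
        have "(\<lambda>\<theta>. g (\<theta>, t)) \<in> borel_measurable lborel"
          using g by (simp add: borel_prod[symmetric])
        then have "(\<lambda>\<theta>. g (\<theta>, t)) \<in> borel_measurable lebesgue"
          by (rule measurable_completion)
        moreover have "AE \<theta> in lborel. g (\<theta>, t) = h (\<theta>, t)"
          using elim by eventually_elim (simp add: hgN)
        then have "AE \<theta> in lebesgue. g (\<theta>, t) = h (\<theta>, t)"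
          by (rule AE_completion)
        ultimately have "(\<lambda>\<theta>. h (\<theta>, t)) \<in> borel_measurable lebesgue"
          by (rule borel_measurable_AE)
        then have "(\<lambda>\<theta>. h (\<theta>, t)) \<in> borel_measurable (lebesgue_on S)"
          by (rule measurable_restrict_space1)
        then show "(\<lambda>\<theta>. f (\<theta>, t) \<bullet> i) \<in> borel_measurable (lebesgue_on S)"
          by (rule measurable_cong[THEN iffD1, rotated]) (use t in \<open>simp add: h_def\<close>)
      qed
    qed
  qed
  then have "AE t in lborel. \<forall>i\<in>Basis. t \<in> T \<longrightarrow> (\<lambda>\<theta>. f (\<theta>, t) \<bullet> i) \<in> borel_measurable (lebesgue_on S)"
    by (intro AE_finite_allI) auto
  then show ?thesis
    by eventually_elim (subst borel_measurable_euclidean_space, blast)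
qed

lemma AE_imp_ex_between:
  fixes a b :: real
  assumes "AE s in lborel. P s" "a < b"
  shows "\<exists>s\<in>{a<..<b}. P s"
proof (rule ccontr)
  assume none: "\<not> ?thesis"
  obtain N where N: "N \<in> null_sets lborel" "{s. \<not> P s} \<subseteq> N"
    using assms(1) by (auto simp: eventually_ae_filter)
  have "{a<..<b} \<subseteq> N"
    using none N(2) by blast
  then have "{a<..<b} \<in> null_sets lborel"
    by (rule null_sets_subset[OF N(1), rotated]) simp
  then have "emeasure lborel {a<..<b} = 0"
    by (rule null_setsD1)
  then show False
    using assms(2) by simp
qed

text \<open>Times with a measurable section have full measure and hence accumulate at t from the
  right, which stays inside \<open>{0..}\<close> even for t = 0. By continuity the section at t is a
  pointwise limit of theirs.\<close>

lemma section_measurable_of_continuous: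
  fixes f :: "real \<times> real \<Rightarrow> 'b::euclidean_space"
  assumes f: "f \<in> borel_measurable (lebesgue_on (S \<times> {0..}))" and S: "S \<in> sets borel"
    and cont: "\<And>\<theta>. \<theta> \<in> S \<Longrightarrow> continuous_on {0..} (\<lambda>t. f (\<theta>, t))" and t: "0 \<le> t"
  shows "(\<lambda>\<theta>. f (\<theta>, t)) \<in> borel_measurable (lebesgue_on S)"
proof -
  have good: "AE s in lborel. 0 \<le> s \<longrightarrow> (\<lambda>\<theta>. f (\<theta>, s)) \<in> borel_measurable (lebesgue_on S)"
    using AE_section_measurable[OF f S] by simp
  have "\<exists>s\<in>{t<..<t + inverse (real (Suc n))}. 0 \<le> s \<longrightarrow> (\<lambda>\<theta>. f (\<theta>, s)) \<in> borel_measurable (lebesgue_on S)" for n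
    using good by (rule AE_imp_ex_between) simp
  then obtain s where s: "\<And>n. s n \<in> {t<..<t + inverse (real (Suc n))}"
    "\<And>n. 0 \<le> s n \<Longrightarrow> (\<lambda>\<theta>. f (\<theta>, s n)) \<in> borel_measurable (lebesgue_on S)"
    by metis
  have s0: "0 \<le> s n" for n
    using s(1)[of n] t by auto
  have "s \<longlonglongrightarrow> t"
  proof (rule tendsto_sandwich[OF _ _ tendsto_const])
    show "(\<lambda>n. t + inverse (real (Suc n))) \<longlonglongrightarrow> t"
      using tendsto_add[OF tendsto_const LIMSEQ_inverse_real_of_nat, of t] by simp
  qed (use s(1) in \<open>auto intro!: always_eventually less_imp_le simp del: of_nat_Suc\<close>)
  show ?thesis
  proof (rule borel_measurable_LIMSEQ_metric)
    show "(\<lambda>\<theta>. f (\<theta>, s n)) \<in> borel_measurable (lebesgue_on S)" for n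
      using s(2)[OF s0] .
    show "(\<lambda>n. f (\<theta>, s n)) \<longlonglongrightarrow> f (\<theta>, t)" if "\<theta> \<in> space (lebesgue_on S)" for \<theta>
      using that by (intro continuous_on_tendsto_compose[OF cont \<open>s \<longlonglongrightarrow> t\<close>]) (use t s0 in auto)
  qed
qed

text \<open>Rounding t down to a multiple of 1 / (n + 1) leaves only countably many sections to
  combine; continuity in t recovers X as n grows.\<close>

lemma Caratheodory_measurable:
  fixes X :: "'a \<Rightarrow> real \<Rightarrow> 'b::metric_space"
  assumes meas: "\<And>t. 0 \<le> t \<Longrightarrow> (\<lambda>\<theta>. X \<theta> t) \<in> borel_measurable M"
    and cont: "\<And>\<theta>. \<theta> \<in> space M \<Longrightarrow> continuous_on {0..} (X \<theta>)"
  shows "(\<lambda>(\<theta>, t). X \<theta> t) \<in> borel_measurable (M \<Otimes>\<^sub>M restrict_space lborel {0::real..})"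
proof -
  define s where "s n t = real (nat \<lfloor>real (Suc n) * t\<rfloor>) / real (Suc n)" for n t
  have s: "0 \<le> s n t" "t - inverse (real (Suc n)) \<le> s n t" "s n t \<le> t" if "0 \<le> t" for n t
  proof -
    have eq: "real (nat \<lfloor>real (Suc n) * t\<rfloor>) = of_int \<lfloor>real (Suc n) * t\<rfloor>"
      using that by simp
    have "real (Suc n) * t - 1 \<le> of_int \<lfloor>real (Suc n) * t\<rfloor>" "of_int \<lfloor>real (Suc n) * t\<rfloor> \<le> real (Suc n) * t"
      by linarith+
    then show "t - inverse (real (Suc n)) \<le> s n t" "s n t \<le> t"
      unfolding s_def eq
      by (simp_all add: pos_le_divide_eq pos_divide_le_eq left_diff_distrib right_diff_distrib mult.commute del: of_nat_Suc)
  qed (simp add: s_def)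
  have lim: "(\<lambda>n. s n t) \<longlonglongrightarrow> t" if "0 \<le> t" for t
  proof (rule tendsto_sandwich[OF _ _ _ tendsto_const])
    show "(\<lambda>n. t - inverse (real (Suc n))) \<longlonglongrightarrow> t"
      using tendsto_diff[OF tendsto_const LIMSEQ_inverse_real_of_nat, of t] by simp
  qed (use s[OF that] in \<open>auto intro!: always_eventually simp del: of_nat_Suc\<close>)
  show ?thesis
  proof (rule borel_measurable_LIMSEQ_metric)
    fix n
    have "(\<lambda>z. X (fst z) (real k / real (Suc n))) \<in> borel_measurable (M \<Otimes>\<^sub>M restrict_space lborel {0::real..})" for k
      by (rule measurable_compose[OF measurable_fst meas]) simp
    moreover have "(\<lambda>z. nat \<lfloor>real (Suc n) * snd z\<rfloor>) \<in> measurable (M \<Otimes>\<^sub>M restrict_space lborel {0::real..}) (count_space UNIV)"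
    proof (rule measurable_compose[OF measurable_snd])
      show "(\<lambda>t. nat \<lfloor>real (Suc n) * t\<rfloor>) \<in> measurable (restrict_space lborel {0::real..}) (count_space UNIV)"
        by (intro measurable_restrict_space1) measurable
    qed
    ultimately show "(\<lambda>z. X (fst z) (s n (snd z))) \<in> borel_measurable (M \<Otimes>\<^sub>M restrict_space lborel {0::real..})"
      unfolding s_def by (rule measurable_compose_countable)
  next
    fix z assume "z \<in> space (M \<Otimes>\<^sub>M restrict_space lborel {0::real..})"
    then have z: "fst z \<in> space M" "0 \<le> snd z"
      by (auto simp: space_pair_measure space_restrict_space)
    show "(\<lambda>n. X (fst z) (s n (snd z))) \<longlonglongrightarrow> (case z of (\<theta>, t) \<Rightarrow> X \<theta> t)"
      using continuous_on_tendsto_compose[OF cont[OF z(1)] lim[OF z(2)]] s[OF z(2)] z(2)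
      by (simp add: split_beta)
  qed
qed

lemma closure_Rats_greaterThan: "closure (\<rat> \<inter> {a<..}) = {a::real..}"
proof (intro equalityI subsetI)
  fix x assume "x \<in> closure (\<rat> \<inter> {a<..})"
  moreover have "closure (\<rat> \<inter> {a<..}) \<subseteq> {a..}"
    by (rule closure_minimal) auto
  ultimately show "x \<in> {a..}"
    by blast
next
  fix x assume x: "x \<in> {a..}"
  show "x \<in> closure (\<rat> \<inter> {a<..})"
    unfolding closure_approachable
  proof (intro allI impI)
    fix e :: real assume "e > 0"
    then obtain r where "r \<in> \<rat>" "x < r" "r < x + e"
      using Rats_dense_in_real[of x "x + e"] by auto
    then show "\<exists>y\<in>\<rat> \<inter> {a<..}. dist y x < e"
      using x by (intro bexI[of _ r]) (auto simp: dist_real_def)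
  qed
qed

section \<open>Distance from a point to a path, and measurability of the mollified
  multiplicity\<close>

abbreviation path_gap :: "(real \<Rightarrow> 'a::real_normed_vector) \<Rightarrow> 'a \<Rightarrow> real" where
  "path_gap \<gamma> x \<equiv> INF t\<in>{0..}. norm (\<gamma> t - x)"

lemma path_gap_le: "0 \<le> t \<Longrightarrow> path_gap \<gamma> x \<le> norm (\<gamma> t - x)"
  by (intro cINF_lower bdd_belowI[of _ 0]) auto

lemma path_gap_nonneg: "0 \<le> path_gap \<gamma> x"
  by (intro cINF_greatest) auto

text \<open>Density of the positive rationals in \<open>{0..}\<close> and continuity make the
  infimum countable, hence measurable in \<theta> and x.\<close>

lemma path_gap_eq_Rats:
  assumes "continuous_on {0..} \<gamma>"
  shows "path_gap \<gamma> x = (INF t\<in>\<rat> \<inter> {0<..}. norm (\<gamma> t - x))"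
proof (rule antisym)
  have ne: "\<rat> \<inter> {0<..} \<noteq> ({} :: real set)"
    using Rats_1 zero_less_one by blast
  then show "path_gap \<gamma> x \<le> (INF t\<in>\<rat> \<inter> {0<..}. norm (\<gamma> t - x))"
    by (intro cINF_greatest path_gap_le) auto
  have "(INF t\<in>\<rat> \<inter> {0<..}. norm (\<gamma> t - x)) \<le> norm (\<gamma> t - x)" if "0 \<le> t" for t
  proof (rule continuous_ge_on_closure[of "\<rat> \<inter> {0<..}" "\<lambda>t. norm (\<gamma> t - x)"])
    show "continuous_on (closure (\<rat> \<inter> {0<..})) (\<lambda>t. norm (\<gamma> t - x))"
      unfolding closure_Rats_greaterThan by (intro continuous_intros assms)
  qed (use that in \<open>auto simp: closure_Rats_greaterThan intro!: cINF_lower bdd_belowI[of _ 0]\<close>)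
  then show "(INF t\<in>\<rat> \<inter> {0<..}. norm (\<gamma> t - x)) \<le> path_gap \<gamma> x"
    by (intro cINF_greatest) auto
qed

lemma plan_lipschitz:
  assumes "chi \<in> irrigation_plans \<mu>" "\<theta> \<in> Theta \<mu>"
  shows "1-lipschitz_on {0..} (chi \<theta>)"
  using assms by (simp add: irrigation_plans_def)

lemma plan_continuous:
  assumes "chi \<in> irrigation_plans \<mu>" "\<theta> \<in> Theta \<mu>"
  shows "continuous_on {0..} (chi \<theta>)"
  using plan_lipschitz[OF assms] by (rule lipschitz_on_continuous_on)

lemma plan_section_measurable:
  assumes "chi \<in> irrigation_plans \<mu>" "0 \<le> t"
  shows "(\<lambda>\<theta>. chi \<theta> t) \<in> borel_measurable (lebesgue_on (Theta \<mu>))"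
proof -
  have "(\<lambda>\<theta>. (\<lambda>(\<theta>, t). chi \<theta> t) (\<theta>, t)) \<in> borel_measurable (lebesgue_on (Theta \<mu>))"
  proof (rule section_measurable_of_continuous)
    show "(\<lambda>(\<theta>, t). chi \<theta> t) \<in> borel_measurable (lebesgue_on (Theta \<mu> \<times> {0..}))"
      using assms(1) by (simp add: irrigation_plans_def)
  qed (use plan_continuous[OF assms(1)] assms(2) in \<open>auto simp: Theta_def\<close>)
  then show ?thesis
    by simp
qed

text \<open>The product \<sigma>-algebra here is smaller than the Lebesgue one in the definition of
  plans; it is the one that iterated integration requires. Continuity of the paths bridges the
  difference.\<close>

lemma plan_jointly_measurable:
  assumes "chi \<in> irrigation_plans \<mu>"
  shows "(\<lambda>(\<theta>, t). chi \<theta> t) \<in> borel_measurable (lebesgue_on (Theta \<mu>) \<Otimes>\<^sub>M restrict_space lborel {0::real..})"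
  by (rule Caratheodory_measurable) (auto intro: plan_section_measurable plan_continuous assms)

lemma finite_measure_Theta: "finite_measure (lebesgue_on (Theta \<mu>))"
  by (rule finite_measure_lebesgue_on) (simp add: Theta_def)

lemma mollifier_antimono:
  assumes "mollifier J" "0 \<le> r" "r \<le> s"
  shows "J s \<le> J r"
proof -
  have "antimono_on {0..} J"
    using assms(1) by (simp add: mollifier_def)
  from monotone_onD[OF this, of r s] assms show ?thesis
    by simp
qed

lemma mollifier_bounds:
  assumes "mollifier J" "0 \<le> r"
  shows "0 \<le> J r" "J r \<le> 1"
proof -
  show "0 \<le> J r"
    using assms by (simp add: mollifier_def)
  have "J r \<le> J 0"
    using assms(2) by (intro mollifier_antimono[OF assms(1)]) auto
  then show "J r \<le> 1"
    using assms by (simp add: mollifier_def)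
qed

text \<open>One-sided, as only upper bounds for \<open>W\<close> are wanted: monotonicity of J
  covers v \<le> u, and the Lipschitz constant is spent only on the excess v - u \<le>
  \<eta>.\<close>

lemma mollifier_scaled_le:
  assumes J: "mollifier J" and lip: "L-lipschitz_on {0..} J" and \<epsilon>: "\<epsilon> > 0"
    and uv: "0 \<le> u" "0 \<le> v" "v \<le> u + \<eta>" and "0 \<le> \<eta>"
  shows "J (u / \<epsilon>) \<le> J (v / \<epsilon>) + L * (\<eta> / \<epsilon>)"
proof -
  have L: "0 \<le> L"
    using lip by (rule lipschitz_on_nonneg)
  show ?thesis
  proof (cases "v \<le> u")
    case True
    then have "J (u / \<epsilon>) \<le> J (v / \<epsilon>)"
      using \<epsilon> uv by (intro mollifier_antimono[OF J] divide_right_mono) auto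
    moreover have "0 \<le> L * (\<eta> / \<epsilon>)"
      using L \<epsilon> \<open>0 \<le> \<eta>\<close> by simp
    ultimately show ?thesis
      by linarith
  next
    case False
    have "J (u / \<epsilon>) - J (v / \<epsilon>) \<le> L * dist (u / \<epsilon>) (v / \<epsilon>)"
      using lipschitz_onD[OF lip, of "u / \<epsilon>" "v / \<epsilon>"] uv \<epsilon> by (simp add: dist_real_def)
    also have "dist (u / \<epsilon>) (v / \<epsilon>) \<le> \<eta> / \<epsilon>"
      using False uv \<epsilon> by (simp add: dist_real_def divide_right_mono flip: diff_divide_distrib)
    then have "L * dist (u / \<epsilon>) (v / \<epsilon>) \<le> L * (\<eta> / \<epsilon>)"
      using L by (rule mult_left_mono)
    finally show ?thesis
      by simp
  qed
qed

text \<open>Joint measurability in x and \<theta> is what makes \<open>W\<close> a Borel function of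
  x after integration over \<theta>, so that it can be evaluated along the paths.\<close>

lemma mollified_gap_measurable:
  fixes chi :: "real \<Rightarrow> real \<Rightarrow> real ^ 'd"
  assumes chi: "chi \<in> irrigation_plans \<mu>" and J: "mollifier J" and \<epsilon>: "\<epsilon> > 0"
  shows "(\<lambda>(x, \<theta>). J (path_gap (chi \<theta>) x / \<epsilon>)) \<in> borel_measurable (borel \<Otimes>\<^sub>M lebesgue_on (Theta \<mu>))"
    (is "_ \<in> borel_measurable ?M")
proof -
  have sec: "(\<lambda>z. norm (chi (snd z) t - fst z)) \<in> borel_measurable ?M" if "0 \<le> t" for t
  proof -
    have [measurable]: "(\<lambda>z. chi (snd z) t) \<in> borel_measurable ?M"
      by (rule measurable_compose[OF measurable_snd plan_section_measurable[OF chi that]])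
    show ?thesis
      by measurable
  qed
  have "(\<lambda>z. INF t\<in>\<rat> \<inter> {0<..}. norm (chi (snd z) t - fst z)) \<in> borel_measurable ?M"
    by (intro borel_measurable_cINF_real sec) (auto intro: countable_Int1 countable_rat)
  then have gap: "(\<lambda>z. path_gap (chi (snd z)) (fst z)) \<in> borel_measurable ?M"
    by (rule measurable_cong[THEN iffD1, rotated])
       (use plan_continuous[OF chi] in \<open>auto simp: space_pair_measure path_gap_eq_Rats\<close>)
  obtain L where L: "L-lipschitz_on {0..} J"
    using J by (auto simp: mollifier_def)
  \<comment> \<open>J is controlled only on \<open>{0..}\<close>; truncating the argument at 0 gives
    a continuous function on the line with the same values at all gaps.\<close>
  have "continuous_on UNIV (\<lambda>r. J (max 0 r))"
    by (rule continuous_on_compose2[OF lipschitz_on_continuous_on[OF L]]) (auto intro!: continuous_intros)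
  then have "(\<lambda>r. J (max 0 r)) \<in> borel_measurable borel"
    by (rule borel_measurable_continuous_onI)
  then have "(\<lambda>z. J (max 0 (path_gap (chi (snd z)) (fst z) / \<epsilon>))) \<in> borel_measurable ?M"
    by (rule measurable_compose[rotated]) (intro borel_measurable_divide gap borel_measurable_const)
  moreover have "max 0 (path_gap (chi \<theta>) x / \<epsilon>) = path_gap (chi \<theta>) x / \<epsilon>" for \<theta> x
    using path_gap_nonneg[of "chi \<theta>" x] \<epsilon> by simp
  ultimately show ?thesis
    by (simp add: split_beta)
qed

lemma W_measurable:
  fixes chi :: "real \<Rightarrow> real \<Rightarrow> real ^ 'd"
  assumes "chi \<in> irrigation_plans \<mu>" "mollifier J" "\<epsilon> > 0"
  shows "W \<mu> J \<epsilon> chi \<in> borel_measurable borel"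
proof -
  interpret finite_measure "lebesgue_on (Theta \<mu>)"
    by (rule finite_measure_Theta)
  show ?thesis
    unfolding W_def[abs_def]
    using mollified_gap_measurable[OF assms] by (rule borel_measurable_lebesgue_integral)
qed

lemma W_nonneg:
  assumes "mollifier J" "\<epsilon> > 0"
  shows "0 \<le> W \<mu> J \<epsilon> chi x"
  unfolding W_def
  by (intro Bochner_Integration.integral_nonneg mollifier_bounds(1)[OF assms(1)]
      divide_nonneg_nonneg path_gap_nonneg less_imp_le[OF assms(2)])

lemma mollified_gap_section_measurable:
  fixes chi :: "real \<Rightarrow> real \<Rightarrow> real ^ 'd"
  assumes "chi \<in> irrigation_plans \<mu>" "mollifier J" "\<epsilon> > 0"
  shows "(\<lambda>\<theta>. J (path_gap (chi \<theta>) x / \<epsilon>)) \<in> borel_measurable (lebesgue_on (Theta \<mu>))"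
  using measurable_compose[OF measurable_Pair1' mollified_gap_measurable[OF assms], of x] by simp

section \<open>Moving and resting paths\<close>

text \<open>The negation says that the path rests from t on. For t > 0 other than the stopping time
  this is a comparison of t with \<open>stopping_time\<close>, but phrased through values of the
  path, which suits both measurability and limits.\<close>

definition moves_after :: "(real \<Rightarrow> 'a) \<Rightarrow> real \<Rightarrow> bool" where
  "moves_after \<gamma> t \<longleftrightarrow> (\<exists>s>t. \<gamma> s \<noteq> \<gamma> t)"

text \<open>A continuous path that is constant at the rational times after t is constant after t.
  The index set does not depend on t, so the event is a fixed countable union of measurable
  ones.\<close>

lemma moves_after_iff_Rats:
  fixes \<gamma> :: "real \<Rightarrow> 'a::real_normed_vector"
  assumes \<gamma>: "continuous_on {0..} \<gamma>" and t: "0 \<le> t"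
  shows "moves_after \<gamma> t \<longleftrightarrow> (\<exists>s\<in>\<rat> \<inter> {0<..}. t < s \<and> \<gamma> s \<noteq> \<gamma> t)"
proof
  assume "moves_after \<gamma> t"
  then obtain s where s: "t < s" "\<gamma> s \<noteq> \<gamma> t"
    by (auto simp: moves_after_def)
  show "\<exists>s\<in>\<rat> \<inter> {0<..}. t < s \<and> \<gamma> s \<noteq> \<gamma> t"
  proof (rule ccontr)
    assume "\<not> ?thesis"
    then have const: "\<gamma> r = \<gamma> t" if "r \<in> \<rat> \<inter> {t<..}" for r
      using that t by force
    have "continuous_on (closure (\<rat> \<inter> {t<..})) \<gamma>"
      unfolding closure_Rats_greaterThan by (rule continuous_on_subset[OF \<gamma>]) (use t in auto)
    then have "\<gamma> s = \<gamma> t"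
      using const by (rule continuous_constant_on_closure) (use s in \<open>auto simp: closure_Rats_greaterThan\<close>)
    with s show False
      by simp
  qed
qed (auto simp: moves_after_def)

lemma moves_after_measurable:
  assumes chi: "chi \<in> irrigation_plans \<mu>"
  shows "Measurable.pred (lebesgue_on (Theta \<mu>) \<Otimes>\<^sub>M restrict_space lborel {0::real..}) (\<lambda>(\<theta>, t). moves_after (chi \<theta>) t)"
    (is "Measurable.pred ?M _")
proof -
  have [measurable]: "(\<lambda>z. chi (fst z) (snd z)) \<in> borel_measurable ?M"
    using plan_jointly_measurable[OF chi] by (simp add: split_beta)
  have sec: "(\<lambda>z. chi (fst z) s) \<in> borel_measurable ?M" if "s \<in> \<rat> \<inter> {0<..}" for s
    using that by (intro measurable_compose[OF measurable_fst plan_section_measurable[OF chi]]) auto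
  have [measurable]: "snd \<in> borel_measurable ?M"
    by (rule measurable_compose[OF measurable_snd, of "\<lambda>t. t"]) (intro measurable_restrict_space1, simp)
  have "{z \<in> space ?M. snd z < s \<and> chi (fst z) s \<noteq> chi (fst z) (snd z)} \<in> sets ?M"
    if "s \<in> \<rat> \<inter> {0<..}" for s
  proof -
    note sec[OF that, measurable]
    show ?thesis
      by measurable
  qed
  then have "Measurable.pred ?M (\<lambda>z. \<exists>s\<in>\<rat> \<inter> {0<..}. snd z < s \<and> chi (fst z) s \<noteq> chi (fst z) (snd z))"
    unfolding pred_def
    by (rule sets.sets_Collect_countable_Ex') (assumption, intro countable_Int1 countable_rat)
  then show ?thesis
  proof (rule measurable_cong[THEN iffD1, rotated])
    fix z assume "z \<in> space ?M"
    then have "fst z \<in> Theta \<mu>" "0 \<le> snd z"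
      by (auto simp: space_pair_measure space_restrict_space)
    from moves_after_iff_Rats[OF plan_continuous[OF chi this(1)] this(2)]
    show "(\<exists>s\<in>\<rat> \<inter> {0<..}. snd z < s \<and> chi (fst z) s \<noteq> chi (fst z) (snd z)) =
        (case z of (\<theta>, t) \<Rightarrow> moves_after (chi \<theta>) t)"
      by (simp only: split_beta)
  qed
qed

lemma moves_before_stopping_time:
  assumes "0 < t" "t < stopping_time \<gamma>"
  shows "moves_after \<gamma> t"
proof (rule ccontr)
  assume "\<not> moves_after \<gamma> t"
  then have "\<forall>t'\<ge>t. \<gamma> t' = \<gamma> t"
    by (metis moves_after_def le_less)
  then have "t \<in> {t. t > 0 \<and> (\<forall>t'\<ge>t. \<gamma> t' = \<gamma> t)}"
    using assms(1) by blast
  moreover have "bdd_below {t. t > 0 \<and> (\<forall>t'\<ge>t. \<gamma> t' = \<gamma> t)}"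
    by (rule bdd_belowI[of _ 0]) (blast intro: less_imp_le)
  ultimately have "stopping_time \<gamma> \<le> t"
    unfolding stopping_time_def by (rule cInf_lower)
  with assms(2) show False
    by simp
qed

lemma not_moves_after_stopping_time:
  assumes "\<exists>t\<ge>0. \<forall>t'\<ge>t. \<gamma> t' = \<gamma> t" and t: "stopping_time \<gamma> < t"
  shows "\<not> moves_after \<gamma> t"
proof -
  obtain t0 where t0: "t0 \<ge> 0" "\<And>t'. t' \<ge> t0 \<Longrightarrow> \<gamma> t' = \<gamma> t0"
    using assms(1) by blast
  \<comment> \<open>The path may rest from t0 = 0, whereas the infimum in
    \<open>stopping_time\<close> ranges over positive times; the shift by 1 shows that its set is
    nonempty.\<close>
  have "\<gamma> t' = \<gamma> (t0 + 1)" if "t' \<ge> t0 + 1" for t'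
    using t0(2)[of t'] t0(2)[of "t0 + 1"] that by simp
  moreover have "t0 + 1 > 0"
    using t0(1) by simp
  ultimately have "{t. t > 0 \<and> (\<forall>t'\<ge>t. \<gamma> t' = \<gamma> t)} \<noteq> {}"
    by blast
  from cInf_lessD[OF this t[unfolded stopping_time_def]]
  obtain s where s: "s < t" "\<And>t'. t' \<ge> s \<Longrightarrow> \<gamma> t' = \<gamma> s"
    by blast
  have "\<gamma> t' = \<gamma> t" if "t' > t" for t'
    using s(2)[of t'] s(2)[of t] s(1) that by simp
  then show ?thesis
    unfolding moves_after_def by blast
qed

section \<open>Uniform convergence on bounded time intervals\<close>

text \<open>A value above the essential supremum would persist, by continuity, on a subinterval of
  positive length.\<close>

lemma le_esssup_of_continuous:
  fixes g :: "real \<Rightarrow> real"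
  assumes g: "continuous_on {a..b} g" and "a < b" and t: "t \<in> {a..b}"
  shows "ereal (g t) \<le> esssup (lebesgue_on {a..b}) (\<lambda>s. ereal (g s))"
proof (rule ccontr)
  assume "\<not> ?thesis"
  then obtain c where c: "esssup (lebesgue_on {a..b}) (\<lambda>s. ereal (g s)) < ereal c" "c < g t"
    using ereal_dense2[of "esssup (lebesgue_on {a..b}) (\<lambda>s. ereal (g s))" "ereal (g t)"] by (auto simp: not_le)
  have "AE s in lebesgue_on {a..b}. ereal (g s) \<le> esssup (lebesgue_on {a..b}) (\<lambda>s. ereal (g s))"
    by (rule esssup_AE)
  then have "AE s in lebesgue_on {a..b}. g s \<le> c"
    by eventually_elim (use c(1) in \<open>metis ereal_less_eq(3) le_less order.trans\<close>)
  then have "AE s in lebesgue. s \<in> {a..b} \<longrightarrow> g s \<le> c"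
    by (subst (asm) AE_restrict_space_iff) auto
  then have ae: "AE s in lborel. s \<in> {a..b} \<longrightarrow> g s \<le> c"
    by (simp add: AE_completion_iff)
  obtain d where d: "d > 0" "\<And>s. \<lbrakk>s \<in> {a..b}; dist s t < d\<rbrakk> \<Longrightarrow> dist (g s) (g t) < g t - c"
    using g t c(2) unfolding continuous_on_iff by (metis diff_gt_0_iff_gt)
  obtain s where s: "s \<in> {max a (t - d)<..<min b (t + d)}" "s \<in> {a..b} \<longrightarrow> g s \<le> c"
    using AE_imp_ex_between[OF ae, of "max a (t - d)" "min b (t + d)"] \<open>a < b\<close> t d(1) by auto
  then have "dist (g s) (g t) < g t - c"
    by (intro d(2)) (auto simp: dist_real_def)
  with s show False
    by (auto simp: dist_real_def)
qed

text \<open>A single term of the supremum, with index k \<ge> R, controls all of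
  \<open>{0..R}\<close>; its fixed weight 1 / k is absorbed by the tolerance e / k.\<close>

lemma path_dist_uniform:
  fixes \<gamma> :: "nat \<Rightarrow> real \<Rightarrow> real ^ 'd"
  assumes conv: "(\<lambda>n. path_dist (\<gamma> n) \<gamma>') \<longlonglongrightarrow> 0"
    and cont: "\<And>n. continuous_on {0..} (\<gamma> n)" "continuous_on {0..} \<gamma>'" and e: "e > 0"
  shows "\<forall>\<^sub>F n in sequentially. \<forall>t\<in>{0..R}. norm (\<gamma> n t - \<gamma>' t) < e"
proof -
  obtain k where k: "R \<le> real k" "k \<ge> 1"
    by (metis of_nat_le_iff max.cobounded1 max.cobounded2 order_trans real_arch_simple)
  have "\<forall>\<^sub>F n in sequentially. path_dist (\<gamma> n) \<gamma>' < ereal (e / real k)"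
    using conv by (rule order_tendstoD) (use e k in simp)
  then show ?thesis
  proof eventually_elim
    case (elim n)
    let ?g = "\<lambda>t. norm (\<gamma> n t - \<gamma>' t)"
    show ?case
    proof
      fix t assume t: "t \<in> {0..R}"
      have "ereal (?g t) \<le> esssup (lebesgue_on {0..real k}) (\<lambda>s. ereal (?g s))"
        using k t by (intro le_esssup_of_continuous continuous_intros)
          (auto intro: continuous_on_subset cont)
      then have "ereal (1 / real k) * ereal (?g t) \<le> ereal (1 / real k) * esssup (lebesgue_on {0..real k}) (\<lambda>s. ereal (?g s))"
        by (intro ereal_mult_left_mono) auto
      also have "\<dots> \<le> path_dist (\<gamma> n) \<gamma>'"
        unfolding path_dist_def using k by (intro SUP_upper) auto
      also note elim
      finally show "?g t < e"
        using k by (simp add: divide_less_cancel)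
    qed
  qed
qed

subsection \<open>Semicontinuity\<close>

text \<open>A path that rests from R on has all its points at times up to R, where the convergence
  is uniform, so the gap of the limit exceeds its gap only slightly. For a path still moving after R
  the subtracted 1 makes the left side nonpositive, because J \<le> 1.\<close>

lemma mollified_gap_upper:
  fixes \<gamma> :: "nat \<Rightarrow> real \<Rightarrow> 'a::real_normed_vector"
  assumes J: "mollifier J" and \<epsilon>: "\<epsilon> > 0" and "0 \<le> R"
    and unif: "\<And>e. e > 0 \<Longrightarrow> \<forall>\<^sub>F n in sequentially. \<forall>t\<in>{0..R}. norm (\<gamma> n t - \<gamma>' t) < e"
    and x: "x \<longlonglongrightarrow> x'" and d: "d > 0"
  shows "\<forall>\<^sub>F n in sequentially.
    J (path_gap (\<gamma> n) (x n) / \<epsilon>) - of_bool (moves_after (\<gamma> n) R) \<le> J (path_gap \<gamma>' x' / \<epsilon>) + d"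
proof -
  obtain L where L: "L-lipschitz_on {0..} J"
    using J by (auto simp: mollifier_def)
  then have "0 \<le> L"
    by (rule lipschitz_on_nonneg)
  \<comment> \<open>Chosen so that L * (\<eta> / \<epsilon>) \<le> d; the denominator L + 1 allows
    for L = 0.\<close>
  define \<eta> where "\<eta> = d * \<epsilon> / (L + 1)"
  have \<eta>: "\<eta> > 0"
    using d \<epsilon> \<open>0 \<le> L\<close> by (simp add: \<eta>_def)
  have "L * (\<eta> / \<epsilon>) = d * (L / (L + 1))"
    using \<epsilon> by (simp add: \<eta>_def)
  also have "\<dots> \<le> d * 1"
    using d \<open>0 \<le> L\<close> by (intro mult_left_mono) auto
  finally have L\<eta>: "L * (\<eta> / \<epsilon>) \<le> d"
    by simp
  have "\<forall>\<^sub>F n in sequentially. norm (x n - x') < \<eta> / 2"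
    using tendstoD[OF x, of "\<eta> / 2"] \<eta> by (simp add: dist_norm)
  moreover have "\<forall>\<^sub>F n in sequentially. \<forall>t\<in>{0..R}. norm (\<gamma> n t - \<gamma>' t) < \<eta> / 2"
    using \<eta> by (intro unif) simp
  ultimately show ?thesis
  proof eventually_elim
    case (elim n)
    show ?case
    proof (cases "moves_after (\<gamma> n) R")
      case True
      have "J (path_gap (\<gamma> n) (x n) / \<epsilon>) \<le> 1"
        by (intro mollifier_bounds(2)[OF J] divide_nonneg_nonneg path_gap_nonneg less_imp_le[OF \<epsilon>])
      moreover have "0 \<le> J (path_gap \<gamma>' x' / \<epsilon>)"
        by (intro mollifier_bounds(1)[OF J] divide_nonneg_nonneg path_gap_nonneg less_imp_le[OF \<epsilon>])
      ultimately show ?thesis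
        using True d by simp
    next
      case False
      have "path_gap \<gamma>' x' - \<eta> \<le> norm (\<gamma> n t - x n)" if t: "0 \<le> t" for t
      proof -
        \<comment> \<open>After R the path rests, so its position at t is that at min t R, a time
          covered by the uniform convergence.\<close>
        define s where "s = min t R"
        have s: "0 \<le> s" "s \<le> R"
          using t \<open>0 \<le> R\<close> by (auto simp: s_def)
        have eq: "\<gamma> n t = \<gamma> n s"
          using False by (auto simp: s_def moves_after_def min_def)
        have "path_gap \<gamma>' x' \<le> norm (\<gamma>' s - x')"
          using s(1) by (rule path_gap_le)
        also have "\<gamma>' s - x' = (\<gamma> n s - x n) + (x n - x') - (\<gamma> n s - \<gamma>' s)"
          by simp
        also have "norm \<dots> \<le> norm (\<gamma> n s - x n) + norm (x n - x') + norm (\<gamma> n s - \<gamma>' s)"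
          by (intro order_trans[OF norm_triangle_ineq4] add_right_mono norm_triangle_ineq)
        also have "norm (x n - x') < \<eta> / 2"
          by (rule elim(1))
        also have "norm (\<gamma> n s - \<gamma>' s) < \<eta> / 2"
          using elim(2) s by simp
        finally show ?thesis
          by (simp add: eq)
      qed
      then have "path_gap \<gamma>' x' - \<eta> \<le> path_gap (\<gamma> n) (x n)"
        by (intro cINF_greatest) auto
      then have "J (path_gap (\<gamma> n) (x n) / \<epsilon>) \<le> J (path_gap \<gamma>' x' / \<epsilon>) + L * (\<eta> / \<epsilon>)"
        using \<eta> by (intro mollifier_scaled_le[OF J L \<epsilon>] path_gap_nonneg) simp_all
      with L\<eta> False show ?thesis
        by simp
    qed
  qed
qed

lemma moves_after_section_measurable:
  assumes chi: "chi \<in> irrigation_plans \<mu>" and R: "0 \<le> R"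
  shows "{\<theta> \<in> Theta \<mu>. moves_after (chi \<theta>) R} \<in> sets (lebesgue_on (Theta \<mu>))"
proof -
  have "(\<lambda>\<theta>. (\<theta>, R)) \<in> lebesgue_on (Theta \<mu>) \<rightarrow>\<^sub>M lebesgue_on (Theta \<mu>) \<Otimes>\<^sub>M restrict_space lborel {0::real..}"
    using R by (intro measurable_Pair measurable_ident_sets measurable_const) (auto simp: space_restrict_space)
  from measurable_compose[OF this moves_after_measurable[OF chi]]
  show ?thesis
    by (simp add: pred_def)
qed

text \<open>Markov's inequality, obtained by comparing R times the indicator with the stopping time.
  Only the set has to be measurable for this, not \<open>stopping_time\<close> as a function of
  \<theta>.\<close>

lemma measure_moves_after_le:
  assumes chi: "chi \<in> irrigation_plans \<mu>" and R: "0 < R" and C: "0 \<le> C"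
    and T: "(\<integral>\<^sup>+\<theta>. ennreal (stopping_time (chi \<theta>)) \<partial>lebesgue_on (Theta \<mu>)) \<le> ennreal C"
  shows "measure (lebesgue_on (Theta \<mu>)) {\<theta> \<in> Theta \<mu>. moves_after (chi \<theta>) R} \<le> C / R"
    (is "measure ?M ?A \<le> _")
proof -
  interpret finite_measure ?M
    by (rule finite_measure_Theta)
  have A: "?A \<in> sets ?M"
    using chi less_imp_le[OF R] by (rule moves_after_section_measurable)
  have "R \<le> stopping_time (chi \<theta>)" if "\<theta> \<in> ?A" for \<theta>
  proof (rule ccontr)
    assume "\<not> ?thesis"
    moreover have "\<exists>t\<ge>0. \<forall>t'\<ge>t. chi \<theta> t' = chi \<theta> t"
      using chi that by (auto simp: irrigation_plans_def)
    ultimately have "\<not> moves_after (chi \<theta>) R"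
      by (intro not_moves_after_stopping_time) simp_all
    with that show False
      by simp
  qed
  then have "(\<integral>\<^sup>+\<theta>. ennreal R * indicator ?A \<theta> \<partial>?M) \<le> (\<integral>\<^sup>+\<theta>. ennreal (stopping_time (chi \<theta>)) \<partial>?M)"
    by (intro nn_integral_mono) (auto simp: indicator_def intro!: ennreal_leI)
  also note T
  also have "(\<integral>\<^sup>+\<theta>. ennreal R * indicator ?A \<theta> \<partial>?M) = ennreal (R * measure ?M ?A)"
    using A R by (simp add: nn_integral_cmult_indicator emeasure_eq_measure ennreal_mult)
  finally have "R * measure ?M ?A \<le> C"
    using C by (simp add: ennreal_le_iff)
  then show ?thesis
    using R by (simp add: field_simps)
qed

text \<open>The base points x n move as well, since the multiplicity is evaluated at points of the
  approximating paths. Late movers are split off as a set of small measure; on the remaining paths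
  the integrands are asymptotically at most the limit integrand.\<close>

lemma W_eventually_less:
  fixes chis :: "nat \<Rightarrow> real \<Rightarrow> real \<Rightarrow> real ^ 'd"
  assumes J: "mollifier J" and \<epsilon>: "\<epsilon> > 0" and C: "C > 0"
    and chis: "\<And>n. chis n \<in> irrigation_plans \<mu>" and chi: "chi \<in> irrigation_plans \<mu>"
    and T: "\<And>n. (\<integral>\<^sup>+\<theta>. ennreal (stopping_time (chis n \<theta>)) \<partial>lebesgue_on (Theta \<mu>)) \<le> ennreal C"
    and conv: "plans_converge \<mu> chis chi" and x: "x \<longlonglongrightarrow> x'" and e: "e > 0"
  shows "\<forall>\<^sub>F n in sequentially. W \<mu> J \<epsilon> (chis n) (x n) < W \<mu> J \<epsilon> chi x' + e"
proof -
  let ?M = "lebesgue_on (Theta \<mu>)"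
  interpret finite_measure ?M
    by (rule finite_measure_Theta)
  \<comment> \<open>Markov's inequality then bounds the late movers by C / R = e / 2; the other half
    of e is left for the convergence of the integrals.\<close>
  define R where "R = 2 * C / e"
  have R: "R > 0" "C / R = e / 2"
    using C e by (simp_all add: R_def)
  define A where "A n = {\<theta> \<in> Theta \<mu>. moves_after (chis n \<theta>) R}" for n
  have A[measurable]: "A n \<in> sets ?M" for n
    unfolding A_def using chis R by (intro moves_after_section_measurable) auto
  have A_Int: "A n \<inter> Theta \<mu> = A n" for n
    by (auto simp: A_def)
  have measure_A: "measure ?M (A n) \<le> e / 2" for n
    using measure_moves_after_le[OF chis R(1) less_imp_le[OF C] T] R(2) by (simp add: A_def)
  define j where "j n \<theta> = J (path_gap (chis n \<theta>) (x n) / \<epsilon>)" for n \<theta>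
  define j' where "j' \<theta> = J (path_gap (chi \<theta>) x' / \<epsilon>)" for \<theta>
  \<comment> \<open>Only an upper bound for the limit superior is available pointwise. Taking the
    maximum with the limit integrand \<open>j'\<close> turns it into convergence, so that dominated
    convergence applies on the finite measure space.\<close>
  define h where "h n \<theta> = max (j n \<theta> - indicator (A n) \<theta>) (j' \<theta>)" for n \<theta>
  have j_meas[measurable]: "j n \<in> borel_measurable ?M" "j' \<in> borel_measurable ?M" for n
    unfolding j_def[abs_def] j'_def[abs_def]
    by (intro mollified_gap_section_measurable chis chi J \<epsilon>)+
  have j_bounds: "0 \<le> j n \<theta>" "j n \<theta> \<le> 1" "0 \<le> j' \<theta>" "j' \<theta> \<le> 1" for n \<theta>
    unfolding j_def j'_def
    by (intro mollifier_bounds[OF J] divide_nonneg_nonneg path_gap_nonneg less_imp_le[OF \<epsilon>])+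
  have h_meas[measurable]: "h n \<in> borel_measurable ?M" for n
    unfolding h_def[abs_def] by measurable
  have h_bounds: "0 \<le> h n \<theta>" "h n \<theta> \<le> 1" for n \<theta>
    using j_bounds(1,2)[of n \<theta>] j_bounds(3,4)[of \<theta>] by (auto simp: h_def indicator_def)
  have h_tendsto: "AE \<theta> in ?M. (\<lambda>n. h n \<theta>) \<longlonglongrightarrow> j' \<theta>"
    using conv[unfolded plans_converge_def] AE_space
  proof eventually_elim
    case (elim \<theta>)
    then have \<theta>: "\<theta> \<in> Theta \<mu>"
      by simp
    have unif: "\<forall>\<^sub>F n in sequentially. \<forall>t\<in>{0..R}. norm (chis n \<theta> t - chi \<theta> t) < d" if "d > 0" for d
      using elim(1) that by (intro path_dist_uniform plan_continuous[OF chis \<theta>] plan_continuous[OF chi \<theta>])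
    have upper: "\<forall>\<^sub>F n in sequentially. j n \<theta> - indicator (A n) \<theta> \<le> j' \<theta> + d" if "d > 0" for d
      using mollified_gap_upper[OF J \<epsilon> less_imp_le[OF R(1)] unif x that] \<theta>
      by (simp add: j_def j'_def A_def indicator_def of_bool_def)
    show ?case
    proof (rule tendstoI)
      fix d :: real assume "d > 0"
      then have "\<forall>\<^sub>F n in sequentially. j n \<theta> - indicator (A n) \<theta> \<le> j' \<theta> + d / 2"
        by (intro upper) simp
      then show "\<forall>\<^sub>F n in sequentially. dist (h n \<theta>) (j' \<theta>) < d"
        by eventually_elim (use \<open>d > 0\<close> in \<open>auto simp: h_def dist_real_def\<close>)
    qed
  qed
  have bounded_int: "integrable ?M f" if "f \<in> borel_measurable ?M" "\<And>\<theta>. 0 \<le> f \<theta>" "\<And>\<theta>. f \<theta> \<le> 1" for f :: "real \<Rightarrow> real"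
    using that by (intro integrable_const_bound[of _ 1]) auto
  have "(\<lambda>n. integral\<^sup>L ?M (h n)) \<longlonglongrightarrow> integral\<^sup>L ?M j'"
    using h_tendsto h_bounds by (intro integral_dominated_convergence[where w = "\<lambda>_. 1"]) auto
  then have "\<forall>\<^sub>F n in sequentially. integral\<^sup>L ?M (h n) < integral\<^sup>L ?M j' + e / 2"
    by (rule order_tendstoD) (use e in simp)
  then show ?thesis
  proof eventually_elim
    case (elim n)
    have "W \<mu> J \<epsilon> (chis n) (x n) = integral\<^sup>L ?M (j n)"
      by (simp add: W_def j_def[abs_def])
    also have "\<dots> \<le> (LINT \<theta>|?M. h n \<theta> + indicator (A n) \<theta>)"
    proof (rule integral_mono)
      show "integrable ?M (j n)"
        using j_bounds by (intro bounded_int) auto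
      show "integrable ?M (\<lambda>\<theta>. h n \<theta> + indicator (A n) \<theta>)"
        using h_bounds by (intro Bochner_Integration.integrable_add bounded_int) (auto simp: indicator_def)
    qed (auto simp: h_def)
    also have "\<dots> = integral\<^sup>L ?M (h n) + measure ?M (A n)"
      using h_bounds by (subst Bochner_Integration.integral_add) (auto intro!: bounded_int simp: A_Int indicator_def)
    also have "\<dots> < integral\<^sup>L ?M j' + e"
      using elim measure_A[of n] by simp
    also have "integral\<^sup>L ?M j' = W \<mu> J \<epsilon> chi x'"
      by (simp add: W_def j'_def[abs_def])
    finally show ?case .
  qed
qed

section \<open>The power with exponent \<alpha> - 1\<close>

lemma power_am1_antimono:
  assumes "\<alpha> \<le> 1" "0 \<le> u" "u \<le> w"
  shows "power_am1 \<alpha> w \<le> power_am1 \<alpha> u"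
proof (cases "\<alpha> = 1 \<or> u = 0")
  case True
  then show ?thesis
    using assms by (auto simp: power_am1_def)
next
  case False
  then show ?thesis
    using assms by (auto simp: power_am1_def intro!: ennreal_leI powr_mono2')
qed

text \<open>Right-continuity, including w = 0, where the conventions are exactly the right limits:
  \<infinity> for \<alpha> < 1 and 1 for \<alpha> = 1.\<close>

lemma power_am1_tendsto:
  assumes "\<alpha> \<le> 1" "0 \<le> w"
  shows "(\<lambda>k. power_am1 \<alpha> (w + inverse (real (Suc k)))) \<longlonglongrightarrow> power_am1 \<alpha> w"
proof -
  have pos: "w + inverse (real (Suc k)) \<noteq> 0" for k
  proof -
    have "inverse (real (Suc k)) > 0"
      by simp
    with assms(2) show ?thesis
      by linarith
  qed
  consider "\<alpha> = 1" | "\<alpha> < 1" "w = 0" | "\<alpha> < 1" "w > 0"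
    using assms by linarith
  then show ?thesis
  proof cases
    case 1
    have "power_am1 1 v = 1" for v
      by (simp add: power_am1_def)
    with 1 show ?thesis
      by simp
  next
    case 2
    \<comment> \<open>At w = 0 the approximating powers are (k + 1) to the exponent 1 - \<alpha> >
      0, written with exp and ln.\<close>
    have "LIM k sequentially. exp ((1 - \<alpha>) * ln (real (Suc k))) :> at_top"
      using 2(1)
      by (intro filterlim_compose[OF exp_at_top] filterlim_tendsto_pos_mult_at_top[OF tendsto_const]
          filterlim_compose[OF ln_at_top] filterlim_compose[OF filterlim_real_sequentially] filterlim_Suc) simp
    moreover have "inverse (real (Suc k)) powr (\<alpha> - 1) = exp ((1 - \<alpha>) * ln (real (Suc k)))" for k
      by (simp add: powr_def ln_inverse algebra_simps del: of_nat_Suc)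
    ultimately show ?thesis
      using 2 by (simp add: power_am1_def ennreal_tendsto_top_eq_at_top del: of_nat_Suc)
  next
    case 3
    have "(\<lambda>k. ennreal ((w + inverse (real (Suc k))) powr (\<alpha> - 1))) \<longlonglongrightarrow> ennreal ((w + 0) powr (\<alpha> - 1))"
      by (intro tendsto_ennrealI tendsto_powr tendsto_add tendsto_const LIMSEQ_inverse_real_of_nat) (use 3 in auto)
    then show ?thesis
      using 3 pos by (simp add: power_am1_def del: of_nat_Suc)
  qed
qed

text \<open>A non-increasing right-continuous function turns an upper bound on the limit superior of
  its arguments into a lower bound on the limit inferior of its values.\<close>

lemma power_am1_liminf:
  assumes "\<alpha> \<le> 1" "\<And>n. 0 \<le> w n" "0 \<le> w'"
    and limsup: "\<And>e. e > 0 \<Longrightarrow> \<forall>\<^sub>F n in sequentially. w n < w' + e"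
  shows "power_am1 \<alpha> w' \<le> liminf (\<lambda>n. power_am1 \<alpha> (w n))"
proof (rule LIMSEQ_le_const2[OF power_am1_tendsto[OF assms(1,3)]])
  have "power_am1 \<alpha> (w' + inverse (real (Suc k))) \<le> liminf (\<lambda>n. power_am1 \<alpha> (w n))" for k
  proof (rule Liminf_bounded)
    have "\<forall>\<^sub>F n in sequentially. w n < w' + inverse (real (Suc k))"
      by (intro limsup) simp
    then show "\<forall>\<^sub>F n in sequentially. power_am1 \<alpha> (w' + inverse (real (Suc k))) \<le> power_am1 \<alpha> (w n)"
      by eventually_elim (use assms in \<open>auto intro!: power_am1_antimono\<close>)
  qed
  then show "\<exists>N. \<forall>k\<ge>N. power_am1 \<alpha> (w' + inverse (real (Suc k))) \<le> liminf (\<lambda>n. power_am1 \<alpha> (w n))"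
    by blast
qed

lemma power_am1_measurable [measurable]: "power_am1 \<alpha> \<in> borel_measurable borel"
  unfolding power_am1_def[abs_def] by measurable

section \<open>Speed of the approximating paths and of the limit path\<close>

text \<open>\<open>cost\<close> integrates over completed Lebesgue measure in time, while joint
  measurability is available for the Borel one; this passes from one to the other.\<close>

lemma nn_integral_lebesgue_on_atLeast:
  "(\<integral>\<^sup>+t. f t \<partial>lebesgue_on {a..}) = (\<integral>\<^sup>+t. f t \<partial>restrict_space lborel {a::real..})"
  by (subst (1 2) nn_integral_restrict_space) (simp_all add: nn_integral_completion)

lemma AE_speed_arc_length:
  assumes chi: "chi \<in> irrigation_plans \<mu>" "arc_length_parameterized \<mu> chi" and \<theta>: "\<theta> \<in> Theta \<mu>"
  shows "AE t in lebesgue_on {0..}. speed (chi \<theta>) t = of_bool (moves_after (chi \<theta>) t)"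
proof -
  let ?T = "stopping_time (chi \<theta>)"
  have "AE t in lebesgue_on {0<..<?T}. speed (chi \<theta>) t = 1"
    and zero: "\<And>t. t > ?T \<Longrightarrow> speed (chi \<theta>) t = 0"
    using chi(2) \<theta> by (simp_all add: arc_length_parameterized_def)
  then have "AE t in lebesgue. t \<in> {0<..<?T} \<longrightarrow> speed (chi \<theta>) t = 1"
    by (subst (asm) AE_restrict_space_iff) auto
  \<comment> \<open>The parameterization prescribes no speed at these two times.\<close>
  moreover have "AE t in lebesgue. t \<notin> {0, ?T}"
    by (intro AE_not_in null_sets_completionI countable_imp_null_set_lborel) simp
  ultimately have "AE t in lebesgue. t \<in> {0..} \<longrightarrow> speed (chi \<theta>) t = of_bool (moves_after (chi \<theta>) t)"
  proof eventually_elim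
    case (elim t)
    have "\<exists>t\<ge>0. \<forall>t'\<ge>t. chi \<theta> t' = chi \<theta> t"
      using chi(1) \<theta> by (simp add: irrigation_plans_def)
    from not_moves_after_stopping_time[OF this, of t] zero[of t]
      moves_before_stopping_time[of t "chi \<theta>"] elim
    show ?case
      by (cases t ?T rule: linorder_cases) auto
  qed
  then show ?thesis
    by (subst AE_restrict_space_iff) auto
qed

text \<open>The limit plan need not be parameterized by arc-length, so only this implication is at
  hand: a path resting on a neighbourhood of t has derivative 0 at t.\<close>

lemma AE_moves_after_of_speed_nonzero:
  assumes "\<exists>t\<ge>0. \<forall>t'\<ge>t. \<gamma> t' = \<gamma> t"
  shows "AE t in lebesgue_on {0..}. speed \<gamma> t \<noteq> 0 \<longrightarrow> moves_after \<gamma> t"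
proof -
  have "AE t in lebesgue. t \<notin> {0, stopping_time \<gamma>}"
    by (intro AE_not_in null_sets_completionI countable_imp_null_set_lborel) simp
  then have "AE t in lebesgue. t \<in> {0..} \<longrightarrow> speed \<gamma> t \<noteq> 0 \<longrightarrow> moves_after \<gamma> t"
  proof eventually_elim
    case (elim t)
    show ?case
    proof (intro impI)
      assume t: "t \<in> {0..}" and speed: "speed \<gamma> t \<noteq> 0"
      show "moves_after \<gamma> t"
      proof (cases "t < stopping_time \<gamma>")
        case True
        then show ?thesis
          using elim t by (intro moves_before_stopping_time) auto
      next
        case False
        then have less: "max 0 (stopping_time \<gamma>) < t"
          using elim t by auto
        \<comment> \<open>A midpoint, so that \<gamma> is constant on an open half-line that
          contains t.\<close>
        define s where "s = (max 0 (stopping_time \<gamma>) + t) / 2"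
        have s: "0 < s" "stopping_time \<gamma> < s" "s < t"
          using less by (auto simp: s_def)
        have "\<gamma> r = \<gamma> s" if "r \<in> {s<..}" for r
          using not_moves_after_stopping_time[OF assms s(2)] that unfolding moves_after_def by auto
        then have "speed \<gamma> t = 0"
          using s by (intro speed_eq_0_of_const[of t "{s<..}"]) auto
        with speed show ?thesis
          by simp
      qed
    qed
  qed
  then show ?thesis
    by (subst AE_restrict_space_iff) auto
qed

text \<open>Two distinct limit positions have disjoint neighbourhoods, which the approximating
  positions at the same two times eventually enter.\<close>

lemma moves_after_eventually:
  fixes \<gamma> :: "nat \<Rightarrow> real \<Rightarrow> 'a::t2_space"
  assumes lim: "\<And>s. 0 \<le> s \<Longrightarrow> (\<lambda>n. \<gamma> n s) \<longlonglongrightarrow> \<gamma>' s" and t: "0 \<le> t" "moves_after \<gamma>' t"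
  shows "\<forall>\<^sub>F n in sequentially. moves_after (\<gamma> n) t"
proof -
  obtain s where s: "t < s" "\<gamma>' s \<noteq> \<gamma>' t"
    using t(2) by (auto simp: moves_after_def)
  from hausdorff[OF s(2)] obtain U V
    where UV: "open U" "open V" "\<gamma>' s \<in> U" "\<gamma>' t \<in> V" "U \<inter> V = {}"
    by blast
  have "\<forall>\<^sub>F n in sequentially. \<gamma> n s \<in> U"
    using s(1) t(1) by (intro topological_tendstoD[OF lim UV(1,3)]) simp
  moreover have "\<forall>\<^sub>F n in sequentially. \<gamma> n t \<in> V"
    by (intro topological_tendstoD[OF lim UV(2,4)] t(1))
  ultimately show ?thesis
    by eventually_elim (use UV(5) s(1) in \<open>auto simp: moves_after_def\<close>)
qed

theorem proposition3p2:
  fixes \<mu> :: "(real ^ 'd) measure"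
    and J :: "real \<Rightarrow> real"
    and \<alpha> \<epsilon> C :: real
    and chis :: "nat \<Rightarrow> real \<Rightarrow> real \<Rightarrow> real ^ 'd"
    and chi :: "real \<Rightarrow> real \<Rightarrow> real ^ 'd"
  assumes "radon_measure \<mu>" and "bounded (msupport \<mu>)"
    and "mollifier J"
    and "0 \<le> \<alpha>" and "\<alpha> \<le> 1" and "\<epsilon> > 0"
    and "\<And>n. n \<ge> 1 \<Longrightarrow> chis n \<in> irrigation_plans \<mu>"
    and "\<And>n. n \<ge> 1 \<Longrightarrow> arc_length_parameterized \<mu> (chis n)"
    and "C > 0"
    and "\<And>n. n \<ge> 1 \<Longrightarrow>
      (\<integral>\<^sup>+\<theta>. ennreal (stopping_time (chis n \<theta>)) \<partial>lebesgue_on (Theta \<mu>)) \<le> ennreal C"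
    and "chi \<in> irrigation_plans \<mu>"
    and "plans_converge \<mu> chis chi"
  shows "liminf (\<lambda>n. cost \<mu> J \<alpha> \<epsilon> (chis n)) \<ge> cost \<mu> J \<alpha> \<epsilon> chi"
proof -
  let ?M = "lebesgue_on (Theta \<mu>)" and ?H = "restrict_space lborel {0::real..}"
  note J = assms(3) and \<epsilon> = assms(6) and chi = assms(11)
  \<comment> \<open>The hypotheses on the plans start at index 1 and \<open>chis 0\<close> is
    arbitrary; the shift does not change the limit inferior.\<close>
  define c where "c n = chis (n + 1)" for n
  have c: "c n \<in> irrigation_plans \<mu>" "arc_length_parameterized \<mu> (c n)" for n
    using assms(7,8) by (simp_all add: c_def)
  have T: "(\<integral>\<^sup>+\<theta>. ennreal (stopping_time (c n \<theta>)) \<partial>?M) \<le> ennreal C" for n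
    using assms(10) by (simp add: c_def)
  have conv: "plans_converge \<mu> c chi"
    using assms(12) unfolding plans_converge_def
    by eventually_elim (auto simp: c_def dest: LIMSEQ_ignore_initial_segment[of _ _ 1])
  interpret H: sigma_finite_measure ?H
    by (rule sigma_finite_measure_restrict_space) (simp_all add: lborel.sigma_finite_measure_axioms)
  \<comment> \<open>The cost integrand of \<open>c n\<close> with the speed replaced by an indicator
    equal to it almost everywhere. This version is jointly measurable, as both uses of Fatou's lemma
    require; the integrand of \<open>chi\<close> enters only through monotonicity of the
    integral.\<close>
  define F where "F n \<theta> t = power_am1 \<alpha> (W \<mu> J \<epsilon> (c n) (c n \<theta> t)) * of_bool (moves_after (c n \<theta>) t)" for n \<theta> t
  have F_meas: "(\<lambda>(\<theta>, t). F n \<theta> t) \<in> borel_measurable (?M \<Otimes>\<^sub>M ?H)" for n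
  proof -
    have [measurable]: "(\<lambda>z. power_am1 \<alpha> (W \<mu> J \<epsilon> (c n) (case z of (\<theta>, t) \<Rightarrow> c n \<theta> t))) \<in> borel_measurable (?M \<Otimes>\<^sub>M ?H)"
      by (intro measurable_compose[OF _ power_am1_measurable] measurable_compose[OF _ W_measurable[OF c(1) J \<epsilon>]]
          plan_jointly_measurable c(1))
    note moves_after_measurable[OF c(1)[of n], measurable]
    have "(\<lambda>z. power_am1 \<alpha> (W \<mu> J \<epsilon> (c n) (case z of (\<theta>, t) \<Rightarrow> c n \<theta> t)) *
        (if (case z of (\<theta>, t) \<Rightarrow> moves_after (c n \<theta>) t) then 1 else 0)) \<in> borel_measurable (?M \<Otimes>\<^sub>M ?H)"
      by measurable
    then show ?thesis
      by (simp add: F_def split_beta of_bool_def)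
  qed
  have F_section: "F n \<theta> \<in> borel_measurable ?H" if "\<theta> \<in> space ?M" for n \<theta>
    using measurable_compose[OF measurable_Pair1'[OF that] F_meas, of n] by simp
  have cost_c: "cost \<mu> J \<alpha> \<epsilon> (c n) = (\<integral>\<^sup>+\<theta>. (\<integral>\<^sup>+t. F n \<theta> t \<partial>?H) \<partial>?M)" for n
    unfolding cost_def nn_integral_lebesgue_on_atLeast[symmetric]
  proof (rule nn_integral_cong, rule nn_integral_cong_AE)
    fix \<theta> assume "\<theta> \<in> space ?M"
    then have "AE t in lebesgue_on {0..}. speed (c n \<theta>) t = of_bool (moves_after (c n \<theta>) t)"
      by (intro AE_speed_arc_length[OF c]) simp
    then show "AE t in lebesgue_on {0..}.
        power_am1 \<alpha> (W \<mu> J \<epsilon> (c n) (c n \<theta> t)) * ennreal (speed (c n \<theta>) t) = F n \<theta> t"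
      by eventually_elim (simp add: F_def)
  qed
  have pointwise: "AE \<theta> in ?M. AE t in lebesgue_on {0..}.
      power_am1 \<alpha> (W \<mu> J \<epsilon> chi (chi \<theta> t)) * ennreal (speed (chi \<theta>) t) \<le> liminf (\<lambda>n. F n \<theta> t)"
    using conv[unfolded plans_converge_def] AE_space
  proof eventually_elim
    case (elim \<theta>)
    then have \<theta>: "\<theta> \<in> Theta \<mu>"
      by simp
    have lim: "(\<lambda>n. c n \<theta> t) \<longlonglongrightarrow> chi \<theta> t" if "0 \<le> t" for t
    proof (rule tendstoI)
      fix d :: real assume "d > 0"
      then have "\<forall>\<^sub>F n in sequentially. \<forall>s\<in>{0..t}. norm (c n \<theta> s - chi \<theta> s) < d"
        by (intro path_dist_uniform elim(1) plan_continuous[OF c(1) \<theta>] plan_continuous[OF chi \<theta>])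
      then show "\<forall>\<^sub>F n in sequentially. dist (c n \<theta> t) (chi \<theta> t) < d"
        by eventually_elim (use that in \<open>auto simp: dist_norm\<close>)
    qed
    have "AE t in lebesgue_on {0..}. speed (chi \<theta>) t \<le> 1"
      by (rule AE_speed_le_lipschitz[OF plan_lipschitz[OF chi \<theta>]])
    moreover have "AE t in lebesgue_on {0..}. speed (chi \<theta>) t \<noteq> 0 \<longrightarrow> moves_after (chi \<theta>) t"
      using chi \<theta> by (intro AE_moves_after_of_speed_nonzero) (simp add: irrigation_plans_def)
    ultimately show ?case
      using AE_space
    proof eventually_elim
      case (elim t)
      then have t: "0 \<le> t"
        by simp
      show ?case
      \<comment> \<open>Where the limit speed vanishes the product is 0 even if the power is
        \<infinity>. Elsewhere the limit path moves after t, so the indicators in \<open>F\<close>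
        are eventually 1.\<close>
      proof (cases "speed (chi \<theta>) t = 0")
        case True
        then show ?thesis
          by simp
      next
        case False
        have "power_am1 \<alpha> (W \<mu> J \<epsilon> chi (chi \<theta> t)) * ennreal (speed (chi \<theta>) t)
            \<le> power_am1 \<alpha> (W \<mu> J \<epsilon> chi (chi \<theta> t)) * 1"
          using elim(1) by (intro mult_left_mono) (auto simp: ennreal_le_1)
        also have "\<dots> \<le> liminf (\<lambda>n. power_am1 \<alpha> (W \<mu> J \<epsilon> (c n) (c n \<theta> t)))"
          unfolding mult_1_right
          by (intro power_am1_liminf assms(5) W_nonneg[OF J \<epsilon>]
              W_eventually_less[OF J \<epsilon> assms(9) c(1) chi T conv] lim t)
        also have "\<dots> \<le> liminf (\<lambda>n. F n \<theta> t)"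
        proof (rule Liminf_mono)
          have "\<forall>\<^sub>F n in sequentially. moves_after (c n \<theta>) t"
            using elim(2) False by (intro moves_after_eventually[OF lim] t) auto
          then show "\<forall>\<^sub>F n in sequentially. power_am1 \<alpha> (W \<mu> J \<epsilon> (c n) (c n \<theta> t)) \<le> F n \<theta> t"
            by eventually_elim (simp add: F_def)
        qed
        finally show ?thesis .
      qed
    qed
  qed
  have "cost \<mu> J \<alpha> \<epsilon> chi \<le> (\<integral>\<^sup>+\<theta>. (\<integral>\<^sup>+t. liminf (\<lambda>n. F n \<theta> t) \<partial>?H) \<partial>?M)"
    unfolding cost_def nn_integral_lebesgue_on_atLeast[symmetric]
    using pointwise by (intro nn_integral_mono_AE) (auto elim!: eventually_mono intro!: nn_integral_mono_AE)
  also have "\<dots> \<le> (\<integral>\<^sup>+\<theta>. liminf (\<lambda>n. \<integral>\<^sup>+t. F n \<theta> t \<partial>?H) \<partial>?M)"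
    by (intro nn_integral_mono nn_integral_liminf F_section)
  also have "\<dots> \<le> liminf (\<lambda>n. \<integral>\<^sup>+\<theta>. (\<integral>\<^sup>+t. F n \<theta> t \<partial>?H) \<partial>?M)"
    by (intro nn_integral_liminf H.borel_measurable_nn_integral F_meas)
  also have "\<dots> = liminf (\<lambda>n. cost \<mu> J \<alpha> \<epsilon> (chis (n + 1)))"
    by (simp add: cost_c[symmetric] c_def)
  also have "\<dots> = liminf (\<lambda>n. cost \<mu> J \<alpha> \<epsilon> (chis n))"
    by (rule liminf_shift)
  finally show ?thesis .
qed

end
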